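(* Let $n\ge2$. For any $\rho\ge0$, the subdivision scheme $\mathcal{S}=\{S_k\}_{k\in\mathbb{N}_0}$ with parameter $\rho$ defined in the context is $\mathcal{C}^1$.
   Context: Notation: $\mathbb{N}_0=\{0,1,2,\ldots\}$; $\ell_\infty(\mathbb{Z},\mathbb{R}^n)$ is the set of bounded sequences $f=(f_i)_{i\in\mathbb{Z}}$ with $f_i\in\mathbb{R}^n$; $\nabla f_i:=f_{i+1}-f_i$; $|\cdot|_2$ is the Euclidean norm. Lagrange rules. For $\alpha,\beta\in(0,+\infty)$ let $$a_{-1}(\alpha,\beta)=-\frac{3(4\beta+3)}{64(\alpha^2+\alpha)(\alpha+\beta+1)},\quad a_0(\alpha,\beta)=\frac{3(4\alpha+1)(4\beta+3)}{64\alpha(\beta+1)},$$ $$a_1(\alpha,\beta)=\frac{(4\alpha+1)(4\beta+3)}{64\beta(\alpha+1)},\quad a_2(\alpha,\beta)=-\frac{3(4\alpha+1)}{64(\beta^2+\beta)(\alpha+\beta+1)},$$ $$\Lambda_0[\alpha,\beta](f_{-1},f_0,f_1,f_2)=\sum_{j=-1}^2 a_j(\alpha,\beta)f_j,\qquad \Lambda_1[\alpha,\beta](f_{-1},f_0,f_1,f_2)=\sum_{j=-1}^2 a_{1-j}(\beta,\alpha)f_j .$$ The scheme with parameter $\rho\ge0$. For $A,B>0$ and $k\in\mathbb{N}_0$ let $$\alpha^k(A,B)=\max\left\{(1+2^{-k}\rho)^{-1},\min\left\{1+2^{-k}\rho,\ \frac{1}{A+\frac{\sqrt{A(A+1)B(B+1)}}{B+1}}\right\}\right\},\qquad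 \beta^k(A,B)=\alpha^k(B,A).$$ For column vectors $\delta_{-1},\delta_0,\delta_1\in\mathbb{R}^n$ let $$\mathrm{num}=\det\begin{pmatrix}\delta_{-1}^T\delta_0&\delta_{-1}^T\delta_1\\ \delta_1^T\delta_0&|\delta_1|_2^2\end{pmatrix},\qquad \mathrm{den}=\det\begin{pmatrix}|\delta_{-1}|_2^2&\delta_{-1}^T\delta_1\\ \delta_{-1}^T\delta_1&|\delta_1|_2^2\end{pmatrix},$$ $A(\delta_{-1},\delta_0,\delta_1)=\tfrac12$ if $\mathrm{num}\cdot\mathrm{den}=0$ and $A(\delta_{-1},\delta_0,\delta_1)=|\mathrm{num}/\mathrm{den}|$ otherwise; $B(\delta_{-1},\delta_0,\delta_1)=A(\delta_1,\delta_0,\delta_{-1})$. For $l=0,1$ put $$\Psi^k_l(f_{-1},f_0,f_1,f_2)=\Lambda_l[\bar\alpha,\bar\beta](f_{-1},f_0,f_1,f_2),$$ where $\bar\alpha=\alpha^k(\bar A,\bar B)$, $\bar\beta=\beta^k(\bar A,\bar B)$, $\bar A=A(\nabla f_{-1},\nabla f_0,\nabla f_1)$, $\bar B=B(\nabla f_{-1},\nabla f_0,\nabla f_1)$. The subdivision operators are $S_k:\ell_\infty(\mathbb{Z},\mathbb{R}^n)\to\ell_\infty(\mathbb{Z},\mathbb{R}^n)$, $(S_kf)_{2i+l}=\Psi^k_l(f_{i-1},f_i,f_{i+1},f_{i+2})$, $l=0,1$, $i\in\mathbb{Z}$, and $\mathcal{S}=\{S_k\}_{k\in\mathbb{N}_0}$.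 Convergence and regularity: a sequence $\{f^k\}_{k\in\mathbb{N}_0}$ converges uniformly to a continuous $G:\mathbb{R}\to\mathbb{R}^n$ iff for every compact interval $I\subset\mathbb{R}$, $\lim_{k\to\infty}\sup_{i\in\mathbb{Z}\cap 2^kI}|f^k_i-G(i2^{-k})|=0$. A scheme $\{S_k\}$ is (uniformly) convergent iff for every $f^0\in\ell_\infty(\mathbb{Z},\mathbb{R}^n)$ the sequence $f^{k+1}=S_kf^k$ converges uniformly to a continuous function, denoted $S^\infty f^0$, and $S^\infty\ne0$ (i.e. $S^\infty f^0$ is not the zero function for all $f^0$). It is $\mathcal{C}^1$ iff it is convergent and $S^\infty f^0\in\mathcal{C}^1(\mathbb{R},\mathbb{R}^n)$ for all $f^0\in\ell_\infty(\mathbb{Z},\mathbb{R}^n)$. *)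

theory Defs
  imports "HOL-Analysis.Analysis"
begin

section \<open>Subdivision schemes, convergence and regularity\<close>

type_synonym 'n sequence = "int \<Rightarrow> real ^ 'n"

definition linfty :: "'n::finite sequence set"
  where "linfty = {f. bounded (range f)}"

definition forward_diff :: "'n::finite sequence \<Rightarrow> 'n sequence"
  where "forward_diff f i = f (i + 1) - f i"

text \<open>A scheme \<open>S\<close> is a sequence of operators on \<open>linfty\<close>; \<open>S k\<close> is total on sequences,
  and only its values on bounded sequences matter below.\<close>

type_synonym 'n scheme = "nat \<Rightarrow> 'n sequence \<Rightarrow> 'n sequence"

primrec iterates :: "'n::finite scheme \<Rightarrow> 'n sequence \<Rightarrow> nat \<Rightarrow> 'n sequence" where
  "iterates S f 0 = f"
| "iterates S f (Suc k) = S k (iterates S f k)"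

text \<open>The supremum is taken in \<open>ennreal\<close>, so that it is 0 when no integer lies in
  \<open>2^k I\<close>; the compact intervals are the sets \<open>{a..b}\<close>.\<close>

definition converges_uniformly_to :: "(nat \<Rightarrow> 'n::finite sequence) \<Rightarrow> (real \<Rightarrow> real ^ 'n) \<Rightarrow> bool"
  where "converges_uniformly_to F G \<longleftrightarrow>
    (\<forall>a b :: real. (\<lambda>k. SUP i\<in>{i::int. of_int i \<in> (\<lambda>x. 2 ^ k * x) ` {a..b}}.
              ennreal (norm (F k i - G (of_int i / 2 ^ k)))) \<longlonglongrightarrow> 0)"

text \<open>The limit function is unique when it exists, see \<open>scheme_limit_eqI\<close>.\<close>

definition scheme_limit :: "'n::finite scheme \<Rightarrow> 'n sequence \<Rightarrow> real \<Rightarrow> real ^ 'n"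
  where "scheme_limit S f =
    (THE G. continuous_on UNIV G \<and> converges_uniformly_to (iterates S f) G)"

definition convergent_scheme :: "'n::finite scheme \<Rightarrow> bool"
  where "convergent_scheme S \<longleftrightarrow>
    (\<forall>f\<in>linfty. \<exists>G. continuous_on UNIV G \<and> converges_uniformly_to (iterates S f) G) \<and>
    (\<exists>f\<in>linfty. scheme_limit S f \<noteq> (\<lambda>x. 0))"

definition C1_scheme :: "'n::finite scheme \<Rightarrow> bool"
  where "C1_scheme S \<longleftrightarrow>
    convergent_scheme S \<and> (\<forall>f\<in>linfty. scheme_limit S f C1_differentiable_on UNIV)"


section \<open>Lagrange rules\<close>

text \<open>Only the indices \<open>-1, 0, 1, 2\<close> occur.\<close>

definition lagrange_coeff :: "int \<Rightarrow> real \<Rightarrow> real \<Rightarrow> real"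
  where "lagrange_coeff j \<alpha> \<beta> =
    (if j = -1 then - (3 * (4 * \<beta> + 3)) / (64 * (\<alpha>\<^sup>2 + \<alpha>) * (\<alpha> + \<beta> + 1))
     else if j = 0 then (3 * (4 * \<alpha> + 1) * (4 * \<beta> + 3)) / (64 * \<alpha> * (\<beta> + 1))
     else if j = 1 then ((4 * \<alpha> + 1) * (4 * \<beta> + 3)) / (64 * \<beta> * (\<alpha> + 1))
     else if j = 2 then - (3 * (4 * \<alpha> + 1)) / (64 * (\<beta>\<^sup>2 + \<beta>) * (\<alpha> + \<beta> + 1))
     else 0)"

text \<open>The four arguments \<open>f\<^sub>-\<^sub>1, f\<^sub>0, f\<^sub>1, f\<^sub>2\<close> of a rule are passed as the restriction
  of a sequence \<open>w\<close> to \<open>{-1..2}\<close>.\<close>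

definition Lambda0 :: "real \<Rightarrow> real \<Rightarrow> 'n::finite sequence \<Rightarrow> real ^ 'n"
  where "Lambda0 \<alpha> \<beta> w = (\<Sum>j\<in>{-1..2}. lagrange_coeff j \<alpha> \<beta> *\<^sub>R w j)"

definition Lambda1 :: "real \<Rightarrow> real \<Rightarrow> 'n::finite sequence \<Rightarrow> real ^ 'n"
  where "Lambda1 \<alpha> \<beta> w = (\<Sum>j\<in>{-1..2}. lagrange_coeff (1 - j) \<beta> \<alpha> *\<^sub>R w j)"


section \<open>The nonlinear scheme with parameter \<open>\<rho>\<close>\<close>

definition alpha :: "real \<Rightarrow> nat \<Rightarrow> real \<Rightarrow> real \<Rightarrow> real"
  where "alpha \<rho> k A B =
    max (inverse (1 + \<rho> / 2 ^ k))
        (min (1 + \<rho> / 2 ^ k)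
             (1 / (A + sqrt (A * (A + 1) * B * (B + 1)) / (B + 1))))"

definition beta :: "real \<Rightarrow> nat \<Rightarrow> real \<Rightarrow> real \<Rightarrow> real"
  where "beta \<rho> k A B = alpha \<rho> k B A"

definition num :: "real ^ 'n::finite \<Rightarrow> real ^ 'n \<Rightarrow> real ^ 'n \<Rightarrow> real"
  where "num dm d0 d1 =
    det (vector [vector [dm \<bullet> d0, dm \<bullet> d1],
                 vector [d1 \<bullet> d0, (norm d1)\<^sup>2]] :: real ^ 2 ^ 2)"

definition den :: "real ^ 'n::finite \<Rightarrow> real ^ 'n \<Rightarrow> real ^ 'n \<Rightarrow> real"
  where "den dm d0 d1 =
    det (vector [vector [(norm dm)\<^sup>2, dm \<bullet> d1],
                 vector [dm \<bullet> d1, (norm d1)\<^sup>2]] :: real ^ 2 ^ 2)"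

definition coeffA :: "real ^ 'n::finite \<Rightarrow> real ^ 'n \<Rightarrow> real ^ 'n \<Rightarrow> real"
  where "coeffA dm d0 d1 =
    (if num dm d0 d1 * den dm d0 d1 = 0 then 1 / 2 else \<bar>num dm d0 d1 / den dm d0 d1\<bar>)"

definition coeffB :: "real ^ 'n::finite \<Rightarrow> real ^ 'n \<Rightarrow> real ^ 'n \<Rightarrow> real"
  where "coeffB dm d0 d1 = coeffA d1 d0 dm"

definition Psi :: "real \<Rightarrow> nat \<Rightarrow> int \<Rightarrow> 'n::finite sequence \<Rightarrow> real ^ 'n"
  where "Psi \<rho> k l w =
    (let A = coeffA (forward_diff w (-1)) (forward_diff w 0) (forward_diff w 1);
         B = coeffB (forward_diff w (-1)) (forward_diff w 0) (forward_diff w 1);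
         \<alpha> = alpha \<rho> k A B;
         \<beta> = beta \<rho> k A B
     in if l = 0 then Lambda0 \<alpha> \<beta> w else Lambda1 \<alpha> \<beta> w)"

definition subdiv :: "real \<Rightarrow> 'n::finite scheme"
  where "subdiv \<rho> k f m = Psi \<rho> k (m mod 2) (\<lambda>j. f (m div 2 + j))"


section \<open>Well-definedness\<close>

lemma subdiv_even: "subdiv \<rho> k f (2 * i) = Psi \<rho> k 0 (\<lambda>j. f (i + j))"
  and subdiv_odd: "subdiv \<rho> k f (2 * i + 1) = Psi \<rho> k 1 (\<lambda>j. f (i + j))"
  by (simp_all add: subdiv_def)

lemma converges_uniformly_to_unique:
  fixes F :: "nat \<Rightarrow> 'n::finite sequence"
  assumes G: "continuous_on UNIV G" "converges_uniformly_to F G"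
    and H: "continuous_on UNIV H" "converges_uniformly_to F H"
  shows "G = H"
proof
  fix x :: real
  define s :: "nat \<Rightarrow> int" where "s k = \<lfloor>2 ^ k * x\<rfloor>" for k
  define y :: "nat \<Rightarrow> real" where "y k = of_int (s k) / 2 ^ k" for k
  have y_le: "y k \<le> x" and y_gt: "x - 1 / 2 ^ k < y k" for k
  proof -
    have "of_int (s k) \<le> 2 ^ k * x" "2 ^ k * x < of_int (s k) + 1"
      unfolding s_def by linarith+
    then have "of_int (s k) / 2 ^ k \<le> x" "x < (of_int (s k) + 1) / 2 ^ k"
      by (simp_all add: pos_divide_le_eq pos_less_divide_eq mult.commute)
    then show "y k \<le> x" "x - 1 / 2 ^ k < y k"
      unfolding y_def by (simp_all add: add_divide_distrib)
  qed
  have "(\<lambda>k. x - 1 / 2 ^ k) \<longlonglongrightarrow> x - 0"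
    by (intro tendsto_intros LIMSEQ_divide_realpow_zero) auto
  then have y: "y \<longlonglongrightarrow> x"
    by (intro real_tendsto_sandwich[of "\<lambda>k. x - 1 / 2 ^ k" y _ "\<lambda>_. x"]
        always_eventually allI y_le less_imp_le[OF y_gt]) auto
  have diff: "(\<lambda>k. F k (s k) - L (y k)) \<longlonglongrightarrow> 0" if L: "converges_uniformly_to F L" for L
  proof -
    have mem: "s k \<in> {i. of_int i \<in> (\<lambda>x. 2 ^ k * x) ` {x - 1..x}}" for k
    proof -
      have "(1::real) / 2 ^ k \<le> 1" by (simp add: field_simps)
      then have "x - 1 \<le> y k" using y_gt[of k] by linarith
      then have "y k \<in> {x - 1..x}" using y_le[of k] by simp
      moreover have "of_int (s k) = 2 ^ k * y k" by (simp add: y_def)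
      ultimately show ?thesis by blast
    qed
    have "(\<lambda>k. ennreal (norm (F k (s k) - L (y k)))) \<longlonglongrightarrow> 0"
    proof (rule tendsto_sandwich[OF _ _ tendsto_const])
      show "(\<lambda>k. SUP i\<in>{i::int. of_int i \<in> (\<lambda>x. 2 ^ k * x) ` {x - 1..x}}.
              ennreal (norm (F k i - L (of_int i / 2 ^ k)))) \<longlonglongrightarrow> 0"
        using L unfolding converges_uniformly_to_def by blast
      show "\<forall>\<^sub>F k in sequentially. ennreal (norm (F k (s k) - L (y k))) \<le>
              (SUP i\<in>{i::int. of_int i \<in> (\<lambda>x. 2 ^ k * x) ` {x - 1..x}}.
                 ennreal (norm (F k i - L (of_int i / 2 ^ k))))"
        unfolding y_def by (intro always_eventually allI SUP_upper mem)
    qed auto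
    then have "(\<lambda>k. norm (F k (s k) - L (y k))) \<longlonglongrightarrow> 0"
      by (subst (asm) ennreal_0[symmetric]) (simp del: ennreal_0)
    then show ?thesis by (rule tendsto_norm_zero_cancel)
  qed
  have "(\<lambda>k. (F k (s k) - H (y k)) - (F k (s k) - G (y k))) \<longlonglongrightarrow> 0 - 0"
    by (intro tendsto_diff diff G H)
  then have "(\<lambda>k. G (y k) - H (y k)) \<longlonglongrightarrow> 0"
    by simp
  moreover have "(\<lambda>k. G (y k) - H (y k)) \<longlonglongrightarrow> G x - H x"
    by (intro tendsto_diff continuous_on_tendsto_compose[OF G(1) y] continuous_on_tendsto_compose[OF H(1) y])
      auto
  ultimately have "G x - H x = 0" by (rule LIMSEQ_unique[rotated])
  then show "G x = H x" by simp
qed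

lemma scheme_limit_eqI:
  assumes "continuous_on UNIV G" "converges_uniformly_to (iterates S f) G"
  shows "scheme_limit S f = G"
  unfolding scheme_limit_def
proof (rule the_equality)
  show "continuous_on UNIV G \<and> converges_uniformly_to (iterates S f) G"
    using assms by (rule conjI)
next
  fix H assume "continuous_on UNIV H \<and> converges_uniformly_to (iterates S f) H"
  then show "H = G"
    by (elim conjE) (rule converges_uniformly_to_unique[OF _ _ assms])
qed

lemma coeffA_pos: "coeffA dm d0 d1 > 0" and coeffB_pos: "coeffB dm d0 d1 > 0"
  unfolding coeffB_def coeffA_def by auto

lemma alpha_bounds:
  assumes "\<rho> \<ge> 0"
  shows "alpha \<rho> k A B \<in> {inverse (1 + \<rho>)..1 + \<rho>}"
proof -
  have "\<rho> / 2 ^ k \<le> \<rho>"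
    using assms by (simp add: pos_divide_le_eq mult_le_cancel_left1)
  moreover have "0 \<le> \<rho> / 2 ^ k" using assms by simp
  ultimately have "inverse (1 + \<rho>) \<le> inverse (1 + \<rho> / 2 ^ k)" "inverse (1 + \<rho> / 2 ^ k) \<le> 1"
    "1 + \<rho> / 2 ^ k \<le> 1 + \<rho>" "0 \<le> \<rho>"
    using assms by (auto intro!: le_imp_inverse_le add_pos_nonneg inverse_le_1_iff[THEN iffD2])
  then show ?thesis unfolding alpha_def by auto
qed

lemma lagrange_coeff_simps:
  "lagrange_coeff (-1) \<alpha> \<beta> = - (3 * (4 * \<beta> + 3)) / (64 * (\<alpha>\<^sup>2 + \<alpha>) * (\<alpha> + \<beta> + 1))"
  "lagrange_coeff 0 \<alpha> \<beta> = (3 * (4 * \<alpha> + 1) * (4 * \<beta> + 3)) / (64 * \<alpha> * (\<beta> + 1))"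
  "lagrange_coeff 1 \<alpha> \<beta> = ((4 * \<alpha> + 1) * (4 * \<beta> + 3)) / (64 * \<beta> * (\<alpha> + 1))"
  "lagrange_coeff 2 \<alpha> \<beta> = - (3 * (4 * \<alpha> + 1)) / (64 * (\<beta>\<^sup>2 + \<beta>) * (\<alpha> + \<beta> + 1))"
  "j \<notin> {-1, 0, 1, 2} \<Longrightarrow> lagrange_coeff j \<alpha> \<beta> = 0"
  by (simp_all add: lagrange_coeff_def)

lemma lagrange_coeff_bounded:
  assumes "c > 0"
  obtains M where "\<And>j \<alpha> \<beta>. \<alpha> \<in> {c..d} \<Longrightarrow> \<beta> \<in> {c..d} \<Longrightarrow> \<bar>lagrange_coeff j \<alpha> \<beta>\<bar> \<le> M"
proof -
  define K where "K = {c..d} \<times> {c..d}"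
  have ex: "\<exists>M. \<forall>p\<in>K. \<bar>lagrange_coeff j (fst p) (snd p)\<bar> \<le> M" for j
  proof -
    have pos: "fst p > 0" "snd p > 0" if "p \<in> K" for p
      using that assms by (auto simp: K_def)
    have nz: "64 * ((fst p)\<^sup>2 + fst p) * (fst p + snd p + 1) \<noteq> 0" "64 * fst p * (snd p + 1) \<noteq> 0"
      "64 * snd p * (fst p + 1) \<noteq> 0" "64 * ((snd p)\<^sup>2 + snd p) * (fst p + snd p + 1) \<noteq> 0"
      if "p \<in> K" for p
      using pos[OF that] zero_less_power[of "fst p" 2] zero_less_power[of "snd p" 2]
      unfolding mult_eq_0_iff by linarith+
    have "continuous_on K (\<lambda>p. lagrange_coeff j (fst p) (snd p))"
    proof -
      have
        "continuous_on K (\<lambda>p. - (3 * (4 * snd p + 3)) / (64 * ((fst p)\<^sup>2 + fst p) * (fst p + snd p + 1)))"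
        "continuous_on K (\<lambda>p. (3 * (4 * fst p + 1) * (4 * snd p + 3)) / (64 * fst p * (snd p + 1)))"
        "continuous_on K (\<lambda>p. ((4 * fst p + 1) * (4 * snd p + 3)) / (64 * snd p * (fst p + 1)))"
        "continuous_on K (\<lambda>p. - (3 * (4 * fst p + 1)) / (64 * ((snd p)\<^sup>2 + snd p) * (fst p + snd p + 1)))"
        by (rule continuous_on_divide; (intro ballI, erule nz | force intro!: continuous_intros))+
      note cont = this
      consider "j = -1" | "j = 0" | "j = 1" | "j = 2" | "j \<notin> {-1, 0, 1, 2}" by blast
      then show ?thesis
      proof cases
        case 5
        then show ?thesis by (simp add: lagrange_coeff_simps(5))
      qed (use cont in \<open>simp_all only: lagrange_coeff_simps\<close>)
    qed
    then have "bounded ((\<lambda>p. lagrange_coeff j (fst p) (snd p)) ` K)"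
      unfolding K_def
      by (intro compact_imp_bounded compact_continuous_image compact_Times) auto
    then show ?thesis unfolding bounded_iff by auto
  qed
  then obtain M where M: "\<And>j p. p \<in> K \<Longrightarrow> \<bar>lagrange_coeff j (fst p) (snd p)\<bar> \<le> M j"
    by metis
  have "\<bar>lagrange_coeff j \<alpha> \<beta>\<bar> \<le> (\<Sum>j\<in>{-1..2}. \<bar>M j\<bar>)"
    if "\<alpha> \<in> {c..d}" "\<beta> \<in> {c..d}" for j \<alpha> \<beta>
  proof (cases "j \<in> {-1..2}")
    case True
    have "\<bar>lagrange_coeff j \<alpha> \<beta>\<bar> \<le> \<bar>M j\<bar>"
      using M[of "(\<alpha>, \<beta>)" j] that by (simp add: K_def)
    also have "\<dots> \<le> (\<Sum>j\<in>{-1..2}. \<bar>M j\<bar>)"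
      using True by (intro member_le_sum) auto
    finally show ?thesis .
  next
    case False
    then show ?thesis by (auto simp: lagrange_coeff_def intro!: sum_nonneg)
  qed
  then show ?thesis using that by blast
qed

lemma subdiv_linfty:
  fixes f :: "'n::finite sequence"
  assumes "\<rho> \<ge> 0" "f \<in> linfty"
  shows "subdiv \<rho> k f \<in> linfty"
proof -
  obtain C where C: "\<And>i. norm (f i) \<le> C"
    using assms(2) by (auto simp: linfty_def bounded_iff)
  obtain M where M: "\<And>j \<alpha> \<beta>. \<alpha> \<in> {inverse (1 + \<rho>)..1 + \<rho>} \<Longrightarrow> \<beta> \<in> {inverse (1 + \<rho>)..1 + \<rho>} \<Longrightarrow>
      \<bar>lagrange_coeff j \<alpha> \<beta>\<bar> \<le> M"
    using lagrange_coeff_bounded[of "inverse (1 + \<rho>)" "1 + \<rho>"] assms(1) by auto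
  have bnd: "norm (lagrange_coeff j \<alpha> \<beta> *\<^sub>R f i) \<le> M * C"
    if "\<alpha> \<in> {inverse (1 + \<rho>)..1 + \<rho>}" "\<beta> \<in> {inverse (1 + \<rho>)..1 + \<rho>}" for j \<alpha> \<beta> i
  proof -
    have "0 \<le> M" using M[OF that, of 0] by linarith
    then show ?thesis using M[OF that, of j] C[of i] by (auto intro!: mult_mono)
  qed
  have "norm (Lambda0 \<alpha> \<beta> (\<lambda>j. f (i + j))) \<le> of_nat (card {-1..2::int}) * (M * C)"
    "norm (Lambda1 \<alpha> \<beta> (\<lambda>j. f (i + j))) \<le> of_nat (card {-1..2::int}) * (M * C)"
    if "\<alpha> \<in> {inverse (1 + \<rho>)..1 + \<rho>}" "\<beta> \<in> {inverse (1 + \<rho>)..1 + \<rho>}" for \<alpha> \<beta> i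
    unfolding Lambda0_def Lambda1_def by (intro sum_norm_bound bnd that)+
  then have "norm (subdiv \<rho> k f m) \<le> of_nat (card {-1..2::int}) * (M * C)" for m
    using alpha_bounds[OF assms(1)] unfolding subdiv_def Psi_def Let_def beta_def by presburger
  then show ?thesis unfolding linfty_def bounded_iff by blast
qed

end

theory Submission
  imports Defs
begin

text \<open>
  The parameters \<open>\<alpha>, \<beta>\<close> at level \<open>k\<close> are \<open>1 + O(2^-k)\<close>, so \<open>S\<^sub>k\<close> differs from the linear rule for
  \<open>\<alpha> = \<beta> = 1\<close>, the dual four-point scheme, by \<open>O(2^-k) sup |\<nabla>f|\<close>; this uses that both rules
  reproduce constants. The differences \<open>h\<close> of the divided differences \<open>g\<^sup>k = 2^k \<nabla>f\<^sup>k\<close> are contracted by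
  the factor 21/32 under the dual four-point scheme, while \<open>g\<close> changes by at most \<open>sup |h|\<close>. With the
  summable perturbation, \<open>g\<close> stays bounded and \<open>h\<close> decays like \<open>(3/4)^k\<close>. Hence \<open>f\<^sup>k\<close> and \<open>g\<^sup>k\<close> converge
  uniformly to continuous functions, and the limit of \<open>g\<^sup>k\<close> is the derivative of the limit of \<open>f\<^sup>k\<close>.
\<close>

section \<open>Limits along dyadic refinement\<close>

lemma floor_double_cases:
  fixes x :: real
  obtains l :: int where "l \<in> {0, 1}" "\<lfloor>2 * x\<rfloor> = 2 * \<lfloor>x\<rfloor> + l"
proof -
  have "\<lfloor>2 * x\<rfloor> = 2 * \<lfloor>x\<rfloor> + 0 \<or> \<lfloor>2 * x\<rfloor> = 2 * \<lfloor>x\<rfloor> + 1"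
    by linarith
  then show ?thesis using that by blast
qed

text \<open>Row \<open>k\<close> is read at index \<open>\<lfloor>2 ^ k * x\<rfloor>\<close>; by
  \<open>floor_double_cases\<close>, raising \<open>k\<close> moves from a parent index to one of
  its two children. Each move costs \<open>c * \<nu> ^ k\<close>, so a geometric series gives the
  limit together with its rate.\<close>

lemma dyadic_limit:
  fixes u :: "nat \<Rightarrow> int \<Rightarrow> 'a::banach"
  assumes child: "\<And>k i l. l \<in> {0, 1} \<Longrightarrow> norm (u (Suc k) (2 * i + l) - u k i) \<le> c * \<nu> ^ k"
    and neighbour: "\<And>k i. norm (u k (i + 1) - u k i) \<le> c * \<nu> ^ k"
    and \<nu>: "0 \<le> \<nu>" "\<nu> < 1"
  obtains U :: "real \<Rightarrow> 'a" where "continuous_on UNIV U"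
    "\<And>k x. norm (u k \<lfloor>2 ^ k * x\<rfloor> - U x) \<le> c / (1 - \<nu>) * \<nu> ^ k"
proof -
  define v where "v x k = u k \<lfloor>2 ^ k * x\<rfloor>" for x :: real and k
  define C where "C = c / (1 - \<nu>)"
  have c0: "0 \<le> c" using order_trans[OF norm_ge_zero neighbour[of 0 0]] by simp
  have C0: "0 \<le> C" using c0 \<nu> by (simp add: C_def)
  have C: "c = C * (1 - \<nu>)" using \<nu> by (simp add: C_def)
  have step: "norm (v x (Suc k) - v x k) \<le> c * \<nu> ^ k" for x k
  proof -
    obtain l :: int where l: "l \<in> {0, 1}" "\<lfloor>2 * (2 ^ k * x)\<rfloor> = 2 * \<lfloor>2 ^ k * x\<rfloor> + l"
      by (rule floor_double_cases)
    then show ?thesis using child[OF l(1), of k "\<lfloor>2 ^ k * x\<rfloor>"]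
      by (simp add: v_def mult.assoc)
  qed
  \<comment> \<open>Subtracting the part of the series not yet used closes the induction exactly,
    since \<open>c = C * (1 - \<nu>)\<close>.\<close>
  have tail: "norm (v x (k + n) - v x k) \<le> C * \<nu> ^ k - C * \<nu> ^ (k + n)" for x k n
  proof (induction n)
    case (Suc n)
    have "norm (v x (k + Suc n) - v x k) \<le> norm (v x (Suc (k + n)) - v x (k + n)) + norm (v x (k + n) - v x k)"
      using norm_triangle_ineq[of "v x (Suc (k + n)) - v x (k + n)" "v x (k + n) - v x k"] by simp
    also have "\<dots> \<le> c * \<nu> ^ (k + n) + (C * \<nu> ^ k - C * \<nu> ^ (k + n))"
      by (intro add_mono step Suc)
    also have "\<dots> = C * \<nu> ^ k - C * \<nu> ^ (k + Suc n)"
      by (simp add: C algebra_simps)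
    finally show ?case .
  qed simp
  have tail': "norm (v x (k + n) - v x k) \<le> C * \<nu> ^ k" for x k n
    using tail[of x k n] C0 \<nu> by (smt (verit) mult_nonneg_nonneg zero_le_power)
  have lim0: "(\<lambda>k. a * \<nu> ^ k) \<longlonglongrightarrow> 0" for a
    using tendsto_mult_right_zero[OF LIMSEQ_realpow_zero[OF \<nu>]] .
  have "Cauchy (v x)" for x
  proof (rule metric_CauchyI)
    fix e :: real assume "0 < e"
    then have "\<forall>\<^sub>F k in sequentially. 2 * C * \<nu> ^ k < e"
      using lim0[of "2 * C"] by (intro order_tendstoD)
    then obtain k where k: "2 * C * \<nu> ^ k < e" by (auto simp: eventually_sequentially)
    show "\<exists>M. \<forall>m\<ge>M. \<forall>n\<ge>M. dist (v x m) (v x n) < e"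
    proof (intro exI allI impI)
      fix m n assume "k \<le> m" "k \<le> n"
      then have "dist (v x m) (v x k) \<le> C * \<nu> ^ k" "dist (v x n) (v x k) \<le> C * \<nu> ^ k"
        using tail'[of x k "m - k"] tail'[of x k "n - k"] by (auto simp: dist_norm)
      then show "dist (v x m) (v x n) < e"
        using dist_triangle2[of "v x m" "v x n" "v x k"] k by linarith
    qed
  qed
  then have conv: "convergent (v x)" for x by (simp add: Cauchy_convergent_iff)
  define U where "U x = lim (v x)" for x
  have U: "v x \<longlonglongrightarrow> U x" for x
    using conv by (simp add: U_def convergent_LIMSEQ_iff)
  have bound: "norm (v x k - U x) \<le> C * \<nu> ^ k" for x k
  proof -
    have "(\<lambda>n. norm (v x (n + k) - v x k)) \<longlonglongrightarrow> norm (U x - v x k)"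
      by (intro tendsto_intros LIMSEQ_ignore_initial_segment U)
    then have "norm (U x - v x k) \<le> C * \<nu> ^ k"
      by (rule LIMSEQ_le_const2) (use tail'[of x k] in \<open>auto simp: add.commute\<close>)
    then show ?thesis by (simp add: norm_minus_commute)
  qed
  \<comment> \<open>Points closer than \<open>1 / 2 ^ k\<close> have equal or adjacent indices at
    level \<open>k\<close>. Two approximation errors and one neighbour jump add up to the factor
    \<open>2 * C + c\<close>.\<close>
  have "\<exists>d>0. \<forall>y\<in>UNIV. dist y x < d \<longrightarrow> dist (U y) (U x) < e" if "0 < e" for x e
  proof -
    have "\<forall>\<^sub>F k in sequentially. (2 * C + c) * \<nu> ^ k < e"
      using lim0[of "2 * C + c"] that by (intro order_tendstoD)
    then obtain k where k: "(2 * C + c) * \<nu> ^ k < e" by (auto simp: eventually_sequentially)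
    have "dist (U y) (U x) < e" if y: "dist y x < 1 / 2 ^ k" for y
    proof -
      have "\<bar>2 ^ k * y - 2 ^ k * x\<bar> = 2 ^ k * \<bar>y - x\<bar>"
        by (simp add: right_diff_distrib[symmetric] abs_mult)
      then have "\<bar>2 ^ k * y - 2 ^ k * x\<bar> < 1"
        using y by (simp add: dist_real_def pos_less_divide_eq mult.commute)
      then consider "\<lfloor>2 ^ k * y\<rfloor> = \<lfloor>2 ^ k * x\<rfloor>" | "\<lfloor>2 ^ k * y\<rfloor> = \<lfloor>2 ^ k * x\<rfloor> + 1"
        | "\<lfloor>2 ^ k * x\<rfloor> = \<lfloor>2 ^ k * y\<rfloor> + 1" by linarith
      then have "norm (v y k - v x k) \<le> c * \<nu> ^ k"
      proof cases
        case 1 then show ?thesis using c0 \<nu> by (simp add: v_def)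
      next
        case 2 then show ?thesis using neighbour by (simp add: v_def)
      next
        case 3 then show ?thesis using neighbour by (simp add: v_def norm_minus_commute)
      qed
      then show ?thesis
        using bound[of x k] bound[of y k] k dist_triangle[of "U y" "U x" "v y k"]
          dist_triangle[of "v y k" "U x" "v x k"]
        by (simp add: dist_norm norm_minus_commute algebra_simps)
    qed
    then show ?thesis by (intro exI[of _ "1 / 2 ^ k"]) auto
  qed
  then have "continuous_on UNIV U" by (auto simp: continuous_on_iff)
  then show ?thesis using that bound by (auto simp: v_def C_def)
qed

section \<open>Derivatives of dyadic limits\<close>

lemma tendsto_floor_dyadic: "(\<lambda>k. of_int \<lfloor>2 ^ k * x\<rfloor> / 2 ^ k) \<longlonglongrightarrow> (x :: real)"
proof (rule tendsto_sandwich)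
  show "(\<lambda>k. x - 1 / 2 ^ k) \<longlonglongrightarrow> x"
    using tendsto_diff[OF tendsto_const LIMSEQ_divide_realpow_zero[of 2 1]] by auto
  have "x - 1 / 2 ^ k \<le> of_int \<lfloor>2 ^ k * x\<rfloor> / 2 ^ k" for k
  proof -
    have "(2 ^ k * x - 1) / 2 ^ k \<le> of_int \<lfloor>2 ^ k * x\<rfloor> / 2 ^ k"
      by (intro divide_right_mono) (linarith, simp)
    then show ?thesis by (simp add: diff_divide_distrib)
  qed
  then show "\<forall>\<^sub>F k in sequentially. x - 1 / 2 ^ k \<le> of_int \<lfloor>2 ^ k * x\<rfloor> / 2 ^ k" by simp
  show "\<forall>\<^sub>F k in sequentially. of_int \<lfloor>2 ^ k * x\<rfloor> / 2 ^ k \<le> x"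
    by (intro always_eventually allI) (simp add: pos_divide_le_eq mult.commute)
qed simp

text \<open>Discrete mean value inequality, by telescoping the increments.\<close>

lemma norm_diff_le_steps:
  fixes u :: "int \<Rightarrow> 'a::real_normed_vector"
  assumes "i \<le> j" and "\<And>m. i \<le> m \<Longrightarrow> m < j \<Longrightarrow> norm (u (m + 1) - u m - w) \<le> b"
  shows "norm (u j - u i - of_int (j - i) *\<^sub>R w) \<le> of_int (j - i) * b"
  using assms
proof (induction j rule: int_ge_induct)
  case (step j)
  have "u (j + 1) - u i - of_int (j + 1 - i) *\<^sub>R w
      = (u j - u i - of_int (j - i) *\<^sub>R w) + (u (j + 1) - u j - w)"
    by (simp add: algebra_simps)
  also have "norm \<dots> \<le> of_int (j - i) * b + b"
    using step by (intro norm_triangle_mono) auto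
  finally show ?case by (simp add: algebra_simps)
qed simp

text \<open>Differences of \<open>U\<close> are limits of sums of increments of \<open>u k\<close>,
  each close to a value of \<open>D\<close> divided by \<open>2 ^ k\<close>. This yields a mean
  value inequality for \<open>U\<close>; continuity of \<open>D\<close> at \<open>x\<close> makes
  its error small relative to the distance.\<close>

lemma dyadic_limit_has_vector_derivative:
  fixes u :: "nat \<Rightarrow> int \<Rightarrow> 'a::real_normed_vector"
  assumes U: "\<And>x. (\<lambda>k. u k \<lfloor>2 ^ k * x\<rfloor>) \<longlonglongrightarrow> U x"
    and D: "\<And>k i. norm (2 ^ k *\<^sub>R (u k (i + 1) - u k i) - D (of_int i / 2 ^ k)) \<le> \<epsilon> k"
    and \<epsilon>: "\<epsilon> \<longlonglongrightarrow> 0"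
    and cont: "continuous_on UNIV D"
  shows "(U has_vector_derivative D x) (at x)"
proof -
  \<comment> \<open>The first grid node may lie below \<open>x\<close>, so closeness to
    \<open>d\<close> is required on an interval reaching \<open>\<eta>\<close> further left.\<close>
  have mvt: "norm (U y - U x - (y - x) *\<^sub>R d) \<le> e * (y - x)"
    if "x \<le> y" "0 < \<eta>" and near: "\<And>w. x - \<eta> \<le> w \<Longrightarrow> w \<le> y \<Longrightarrow> norm (D w - d) \<le> e"
    for x y \<eta> e :: real and d
  proof -
    define p where "p k = of_int (\<lfloor>2 ^ k * y\<rfloor> - \<lfloor>2 ^ k * x\<rfloor>) / (2 ^ k :: real)" for k
    have p: "p \<longlonglongrightarrow> y - x"
      using tendsto_diff[OF tendsto_floor_dyadic[of y] tendsto_floor_dyadic[of x]]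
      by (simp add: p_def[abs_def] diff_divide_distrib)
    have "\<forall>\<^sub>F k in sequentially. x - \<eta> < of_int \<lfloor>2 ^ k * x\<rfloor> / 2 ^ k"
      using tendsto_floor_dyadic[of x] \<open>0 < \<eta>\<close> by (intro order_tendstoD) auto
    then have ev: "\<forall>\<^sub>F k in sequentially.
      norm (u k \<lfloor>2 ^ k * y\<rfloor> - u k \<lfloor>2 ^ k * x\<rfloor> - p k *\<^sub>R d) \<le> p k * (e + \<epsilon> k)"
    proof eventually_elim
      case (elim k)
      have le: "\<lfloor>2 ^ k * x\<rfloor> \<le> \<lfloor>2 ^ k * y\<rfloor>"
        using \<open>x \<le> y\<close> by (intro floor_mono mult_left_mono) auto
      have "norm (u k (m + 1) - u k m - (1 / 2 ^ k) *\<^sub>R d) \<le> (e + \<epsilon> k) / 2 ^ k"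
        if m: "\<lfloor>2 ^ k * x\<rfloor> \<le> m" "m < \<lfloor>2 ^ k * y\<rfloor>" for m
      proof -
        have "of_int \<lfloor>2 ^ k * x\<rfloor> / 2 ^ k \<le> (of_int m / 2 ^ k :: real)"
          using m by (intro divide_right_mono) auto
        moreover have "of_int m \<le> 2 ^ k * y" using m by linarith
        ultimately have "norm (D (of_int m / 2 ^ k) - d) \<le> e"
          using elim by (intro near) (linarith, simp add: pos_divide_le_eq mult.commute)
        then have "norm (2 ^ k *\<^sub>R (u k (m + 1) - u k m) - d) \<le> e + \<epsilon> k"
          using norm_triangle_mono[OF D[of k m], of "D (of_int m / 2 ^ k) - d" e]
          by (simp add: add.commute)
        moreover have "u k (m + 1) - u k m - (1 / 2 ^ k) *\<^sub>R d
            = (1 / 2 ^ k) *\<^sub>R (2 ^ k *\<^sub>R (u k (m + 1) - u k m) - d)"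
          by (simp add: scaleR_diff_right)
        ultimately show ?thesis by (simp add: divide_right_mono)
      qed
      from norm_diff_le_steps[of _ _ "u k", OF le this] show ?case
        by (simp add: p_def)
    qed
    have "norm (U y - U x - (y - x) *\<^sub>R d) \<le> (y - x) * (e + 0)"
      by (rule tendsto_le[OF _ _ _ ev]) (intro tendsto_intros U p \<epsilon> | simp)+
    then show ?thesis by (simp add: mult.commute)
  qed
  have "\<exists>\<delta>>0. \<forall>y. norm (y - x) < \<delta> \<longrightarrow> norm (U y - U x - (y - x) *\<^sub>R D x) \<le> e * norm (y - x)"
    if "0 < e" for e
  proof -
    obtain \<delta> where \<delta>: "\<delta> > 0" "\<And>w. dist w x < \<delta> \<Longrightarrow> dist (D w) (D x) < e"
      using cont \<open>0 < e\<close> unfolding continuous_on_iff by blast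
    have near: "norm (D w - D x) \<le> e" if "\<bar>w - x\<bar> < \<delta>" for w
      using \<delta>(2)[of w] that by (simp add: dist_norm)
    have "norm (U y - U x - (y - x) *\<^sub>R D x) \<le> e * norm (y - x)" if y: "norm (y - x) < \<delta> / 2" for y
    proof (cases "x \<le> y")
      case True
      then show ?thesis
        using mvt[of x y "\<delta> / 2" "D x" e, OF True _ near] \<open>\<delta> > 0\<close> y by auto
    next
      \<comment> \<open>The interval is now \<open>{y..x}\<close>, while the reference slope remains
        \<open>D x\<close>. The margin keeps it within the radius, as \<delta>/2 + \<delta>/3 <
        \<delta>.\<close>
      case False
      then have "norm (U x - U y - (x - y) *\<^sub>R D x) \<le> e * (x - y)"
        using \<open>\<delta> > 0\<close> y by (intro mvt[of y x "\<delta> / 3"]) (auto intro!: near)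
      moreover have "U y - U x - (y - x) *\<^sub>R D x = - (U x - U y - (x - y) *\<^sub>R D x)"
        by (simp add: algebra_simps)
      ultimately show ?thesis using False by (simp only: norm_minus_cancel) simp
    qed
    then show ?thesis using \<open>\<delta> > 0\<close> by (intro exI[of _ "\<delta> / 2"]) auto
  qed
  then show ?thesis
    unfolding has_vector_derivative_def has_derivative_at_alt
    by (auto intro: bounded_linear_scaleR_left)
qed

section \<open>Perturbations of the dual four-point scheme\<close>

text \<open>Evaluation of the cubic interpolant to \<open>f\<close> at \<open>i - 1, \<dots>, i + 2\<close> in \<open>i + 1/4\<close> and \<open>i + 3/4\<close>.\<close>

definition dual4 :: "(int \<Rightarrow> 'a::real_vector) \<Rightarrow> int \<Rightarrow> 'a" where
  "dual4 f m = (let i = m div 2 in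
    if even m
    then (- 7 / 128) *\<^sub>R f (i - 1) + (105 / 128) *\<^sub>R f i + (35 / 128) *\<^sub>R f (i + 1) + (- 5 / 128) *\<^sub>R f (i + 2)
    else (- 5 / 128) *\<^sub>R f (i - 1) + (35 / 128) *\<^sub>R f i + (105 / 128) *\<^sub>R f (i + 1) + (- 7 / 128) *\<^sub>R f (i + 2))"

lemma dual4_double:
  "dual4 f (2 * i) = (- 7 / 128) *\<^sub>R f (i - 1) + (105 / 128) *\<^sub>R f i
     + (35 / 128) *\<^sub>R f (i + 1) + (- 5 / 128) *\<^sub>R f (i + 2)"
  "dual4 f (2 * i + 1) = (- 5 / 128) *\<^sub>R f (i - 1) + (35 / 128) *\<^sub>R f i
     + (105 / 128) *\<^sub>R f (i + 1) + (- 7 / 128) *\<^sub>R f (i + 2)"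
  by (simp_all add: dual4_def Let_def)

lemma norm_comb3_le:
  fixes x y z :: "'a::real_normed_vector"
  assumes "norm x \<le> H" "norm y \<le> H" "norm z \<le> H"
  shows "norm (a *\<^sub>R x + b *\<^sub>R y + c *\<^sub>R z) \<le> (\<bar>a\<bar> + \<bar>b\<bar> + \<bar>c\<bar>) * H"
proof -
  have "norm (a *\<^sub>R x + b *\<^sub>R y + c *\<^sub>R z) \<le> norm (a *\<^sub>R x) + norm (b *\<^sub>R y) + norm (c *\<^sub>R z)"
    by (intro norm_triangle_mono) auto
  also have "\<dots> \<le> \<bar>a\<bar> * H + \<bar>b\<bar> * H + \<bar>c\<bar> * H"
    using assms by (auto intro!: add_mono mult_left_mono)
  finally show ?thesis by (simp add: algebra_simps)
qed

text \<open>Both masks sum to 1, so only differences of \<open>f\<close> survive; their weights have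
  absolute sums 42/128 and 110/128.\<close>

lemma dual4_minus_parent:
  fixes f :: "int \<Rightarrow> 'a::euclidean_space"
  assumes "\<And>i. norm (f (i + 1) - f i) \<le> \<delta>" and "l \<in> {0, 1}"
  shows "norm (dual4 f (2 * i + l) - f i) \<le> \<delta>"
proof -
  let ?d = "\<lambda>i. f (i + 1) - f i"
  have eq: "dual4 f (2 * i) - f i = (7 / 128) *\<^sub>R ?d (i - 1) + (30 / 128) *\<^sub>R ?d i + (- 5 / 128) *\<^sub>R ?d (i + 1)"
    "dual4 f (2 * i + 1) - f i = (5 / 128) *\<^sub>R ?d (i - 1) + (98 / 128) *\<^sub>R ?d i + (- 7 / 128) *\<^sub>R ?d (i + 1)"
    unfolding dual4_double by (auto simp: euclidean_eq_iff[of "_ :: 'a"] algebra_simps)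
  have "norm (dual4 f (2 * i) - f i) \<le> 42 / 128 * \<delta>"
    "norm (dual4 f (2 * i + 1) - f i) \<le> 110 / 128 * \<delta>"
    unfolding eq by (rule order_trans[OF norm_comb3_le[where H=\<delta>]], (rule assms(1))+, simp)+
  moreover have "0 \<le> \<delta>" using assms(1) norm_ge_zero order_trans by blast
  ultimately show ?thesis using assms(2) by auto
qed

text \<open>Cubic interpolation reproduces linear data, for which twice the child difference equals
  the parent difference. The discrepancy is therefore a combination of second differences.\<close>

lemma dual4_diff_minus_parent:
  fixes f :: "int \<Rightarrow> 'a::euclidean_space"
  defines "d \<equiv> \<lambda>i. f (i + 1) - f i"
  assumes "\<And>i. norm (d (i + 1) - d i) \<le> H" and "l \<in> {0, 1}"
  shows "norm (2 *\<^sub>R (dual4 f (2 * i + l + 1) - dual4 f (2 * i + l)) - d i) \<le> H"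
proof -
  let ?h = "\<lambda>i. d (i + 1) - d i"
  have next_eq: "2 * i + 2 = 2 * (i + 1)" by simp
  \<comment> \<open>The summand with weight 0 only pads to the shape of
    \<open>norm_comb3_le\<close>. For \<open>l = 1\<close> the difference crosses into cell
    \<open>i + 1\<close>.\<close>
  have eq: "2 *\<^sub>R (dual4 f (2 * i + 1) - dual4 f (2 * i)) - d i
      = (4 / 128) *\<^sub>R ?h (i - 1) + (- 4 / 128) *\<^sub>R ?h i + 0 *\<^sub>R ?h i"
    "2 *\<^sub>R (dual4 f (2 * i + 2) - dual4 f (2 * i + 1)) - d i
      = (10 / 128) *\<^sub>R ?h (i - 1) + (64 / 128) *\<^sub>R ?h i + (- 10 / 128) *\<^sub>R ?h (i + 1)"
    unfolding next_eq dual4_double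
    by (auto simp: d_def euclidean_eq_iff[of "_ :: 'a"] algebra_simps)
  have H: "0 \<le> H" using assms(2) norm_ge_zero order_trans by blast
  have "norm (2 *\<^sub>R (dual4 f (2 * i + 1) - dual4 f (2 * i)) - d i) \<le> 8 / 128 * H"
    "norm (2 *\<^sub>R (dual4 f (2 * i + 2) - dual4 f (2 * i + 1)) - d i) \<le> 84 / 128 * H"
    unfolding eq by (rule order_trans[OF norm_comb3_le[where H=H]], (rule assms(2))+, use H in simp)+
  then show ?thesis using assms(3) H by (auto simp: add.commute)
qed

text \<open>The second-difference masks are (6, 68, -10)/128 and its mirror image, with absolute sum
  84/128 = 21/32. The leading 2 is the rescaling of divided differences between levels, so this is
  the contraction of \<open>h\<close> in the limit argument.\<close>

lemma dual4_second_diff: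
  fixes f :: "int \<Rightarrow> 'a::euclidean_space"
  defines "d \<equiv> \<lambda>i. f (i + 1) - f i"
  assumes "\<And>i. norm (d (i + 1) - d i) \<le> H"
  shows "norm (2 *\<^sub>R (dual4 f (m + 2) - 2 *\<^sub>R dual4 f (m + 1) + dual4 f m)) \<le> 21 / 32 * H"
proof -
  let ?h = "\<lambda>i. d (i + 1) - d i"
  have next_eq: "2 * i + 2 = 2 * (i + 1)" "2 * i + 3 = 2 * (i + 1) + 1" for i :: int by simp_all
  have eq: "2 *\<^sub>R (dual4 f (2 * i + 2) - 2 *\<^sub>R dual4 f (2 * i + 1) + dual4 f (2 * i))
      = (6 / 128) *\<^sub>R ?h (i - 1) + (68 / 128) *\<^sub>R ?h i + (- 10 / 128) *\<^sub>R ?h (i + 1)"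
    "2 *\<^sub>R (dual4 f (2 * i + 3) - 2 *\<^sub>R dual4 f (2 * i + 2) + dual4 f (2 * i + 1))
      = (- 10 / 128) *\<^sub>R ?h (i - 1) + (68 / 128) *\<^sub>R ?h i + (6 / 128) *\<^sub>R ?h (i + 1)" for i
    unfolding next_eq dual4_double
    by (auto simp: d_def euclidean_eq_iff[of "_ :: 'a"] algebra_simps)
  have bound: "norm (2 *\<^sub>R (dual4 f (2 * i + 2) - 2 *\<^sub>R dual4 f (2 * i + 1) + dual4 f (2 * i))) \<le> 21 / 32 * H"
    "norm (2 *\<^sub>R (dual4 f (2 * i + 3) - 2 *\<^sub>R dual4 f (2 * i + 2) + dual4 f (2 * i + 1))) \<le> 21 / 32 * H" for i
    unfolding eq by (rule order_trans[OF norm_comb3_le[where H=H]], (rule assms(2))+, simp)+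
  show ?thesis
  proof (cases "even m")
    case True
    then obtain i where "m = 2 * i" by (elim evenE)
    then show ?thesis using bound(1)[of i] by simp
  next
    case False
    then obtain i where "m = 2 * i + 1" by (elim oddE)
    then show ?thesis using bound(2)[of i] by (simp add: add.assoc)
  qed
qed


text \<open>The nonlinear rule enters only through \<open>perturbation\<close>, stated for every
  bound \<open>\<delta>\<close> so that no suprema are needed. What remains is a linear recursion
  for bounds on \<open>g\<close> and \<open>h\<close>.\<close>

theorem perturbed_dual4_limit:
  fixes F :: "nat \<Rightarrow> int \<Rightarrow> 'a::euclidean_space"
  assumes F0: "bounded (range (F 0))" and C: "0 \<le> C"
    and perturbation: "\<And>k m \<delta>. (\<And>i. norm (F k (i + 1) - F k i) \<le> \<delta>) \<Longrightarrow>
      norm (F (Suc k) m - dual4 (F k) m) \<le> C / 2 ^ k * \<delta>"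
  obtains U D :: "real \<Rightarrow> 'a" and B where "\<And>x. (U has_vector_derivative D x) (at x)" "continuous_on UNIV D"
    "\<And>k i. norm (F k i - U (of_int i / 2 ^ k)) \<le> B / 2 ^ k"
proof -
  define d where "d k i = F k (i + 1) - F k i" for k i
  define g where "g k i = 2 ^ k *\<^sub>R d k i" for k i
  define h where "h k i = g k (i + 1) - g k i" for k i
  define r where "r k m = F (Suc k) m - dual4 (F k) m" for k m
  have d_g: "norm (d k i) \<le> \<Gamma> / 2 ^ k" if "norm (g k i) \<le> \<Gamma>" for k i \<Gamma>
    using that by (simp add: g_def pos_le_divide_eq mult.commute)
  have dd_h: "norm (d k (i + 1) - d k i) \<le> H / 2 ^ k" if "norm (h k i) \<le> H" for k i H
    using that by (simp add: g_def h_def scaleR_diff_right[symmetric] pos_le_divide_eq mult.commute)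
  \<comment> \<open>The relative defect and the differences each contribute a factor 2^-k; after
    scaling by 2^k a summable factor 2^-k is left.\<close>
  have r: "norm (r k m) \<le> C / 2 ^ k * (\<Gamma> / 2 ^ k)" if "\<And>i. norm (g k i) \<le> \<Gamma>" for k m \<Gamma>
    unfolding r_def by (intro perturbation) (use d_g that in \<open>simp add: d_def\<close>)

  \<comment> \<open>Two defects \<open>r\<close>, doubled by the finer scale, give the factor
    4.\<close>
  have g_child: "norm (g (Suc k) (2 * i + l) - g k i) \<le> H + 4 * C / 2 ^ k * \<Gamma>"
    if \<Gamma>: "\<And>i. norm (g k i) \<le> \<Gamma>" and H: "\<And>i. norm (h k i) \<le> H" and l: "l \<in> {0, 1}" for k i l \<Gamma> H
  proof -
    let ?m = "2 * i + l"
    have "g (Suc k) ?m - g k i = 2 ^ k *\<^sub>R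
      ((2 *\<^sub>R (dual4 (F k) (?m + 1) - dual4 (F k) ?m) - d k i) + 2 *\<^sub>R (r k (?m + 1) - r k ?m))"
      by (simp add: g_def d_def r_def algebra_simps)
    moreover have "norm (2 *\<^sub>R (dual4 (F k) (?m + 1) - dual4 (F k) ?m) - d k i) \<le> H / 2 ^ k"
      unfolding d_def using dd_h[OF H] l by (intro dual4_diff_minus_parent) (auto simp: d_def)
    moreover have "norm (r k (?m + 1) - r k ?m) \<le> 2 * (C / 2 ^ k * (\<Gamma> / 2 ^ k))"
      using norm_triangle_ineq4[of "r k (?m + 1)" "r k ?m"] r[OF \<Gamma>, of "?m + 1"] r[OF \<Gamma>, of ?m] by simp
    ultimately have "norm (g (Suc k) ?m - g k i)
        \<le> 2 ^ k * (H / 2 ^ k + 2 * (2 * (C / 2 ^ k * (\<Gamma> / 2 ^ k))))"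
      by (auto intro!: norm_triangle_mono)
    also have "\<dots> = H + 4 * C / 2 ^ k * \<Gamma>" by (simp add: field_simps)
    finally show ?thesis .
  qed
  \<comment> \<open>A second difference weighs the defects 1, 2, 1; doubling gives the factor
    8.\<close>
  have h_step: "norm (h (Suc k) m) \<le> 21 / 32 * H + 8 * C / 2 ^ k * \<Gamma>"
    if \<Gamma>: "\<And>i. norm (g k i) \<le> \<Gamma>" and H: "\<And>i. norm (h k i) \<le> H" for k m \<Gamma> H
  proof -
    let ?S = "dual4 (F k)"
    have "h (Suc k) m = 2 ^ k *\<^sub>R
      (2 *\<^sub>R (?S (m + 2) - 2 *\<^sub>R ?S (m + 1) + ?S m) + 2 *\<^sub>R ((r k (m + 2) - r k (m + 1)) - (r k (m + 1) - r k m)))"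
      by (auto simp: h_def g_def d_def r_def euclidean_eq_iff[of "_ :: 'a"] algebra_simps)
    moreover have "norm (2 *\<^sub>R (?S (m + 2) - 2 *\<^sub>R ?S (m + 1) + ?S m)) \<le> 21 / 32 * (H / 2 ^ k)"
      using dd_h[OF H] by (intro dual4_second_diff) (auto simp: d_def)
    moreover have "norm ((r k (m + 2) - r k (m + 1)) - (r k (m + 1) - r k m)) \<le> 4 * (C / 2 ^ k * (\<Gamma> / 2 ^ k))"
      using norm_triangle_ineq4[of "r k (m + 2) - r k (m + 1)" "r k (m + 1) - r k m"]
        norm_triangle_ineq4[of "r k (m + 2)" "r k (m + 1)"] norm_triangle_ineq4[of "r k (m + 1)" "r k m"]
        r[OF \<Gamma>, of m] r[OF \<Gamma>, of "m + 1"] r[OF \<Gamma>, of "m + 2"] by simp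
    ultimately have "norm (h (Suc k) m)
        \<le> 2 ^ k * (21 / 32 * (H / 2 ^ k) + 2 * (4 * (C / 2 ^ k * (\<Gamma> / 2 ^ k))))"
      by (auto intro!: norm_triangle_mono)
    also have "\<dots> = 21 / 32 * H + 8 * C / 2 ^ k * \<Gamma>" by (simp add: field_simps)
    finally show ?thesis .
  qed

  obtain M where M: "\<And>i. norm (F 0 i) \<le> M"
    using F0 by (auto simp: bounded_iff)
  \<comment> \<open>The initial value of \<Gamma> + 4 H is 2 M + 4 * 4 M = 18 M, and 72 C is the sum
    of 36 C / 2^k over all levels.\<close>
  define P where "P = 18 * M * exp (72 * C)"
  have M0: "0 \<le> M" using M norm_ge_zero order_trans by blast
  \<comment> \<open>Passing to the next level multiplies \<open>\<Gamma> + 4 H\<close> by at most \<open>1 + 36 C / 2^k\<close>: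
    the weight 4 makes the contraction of \<open>H\<close> absorb the term \<open>H\<close> in the bound on \<open>g\<close>.\<close>
  have gh_bound: "\<exists>\<Gamma> H. (\<forall>i. norm (g k i) \<le> \<Gamma>) \<and> (\<forall>i. norm (h k i) \<le> H) \<and>
      \<Gamma> + 4 * H \<le> 18 * M * exp (72 * C * (1 - 1 / 2 ^ k))" for k
  proof (induction k)
    case 0
    have "norm (g 0 i) \<le> 2 * M" for i
      using norm_triangle_ineq4[of "F 0 (i + 1)" "F 0 i"] M[of i] M[of "i + 1"] by (simp add: g_def d_def)
    moreover from this have "norm (h 0 i) \<le> 4 * M" for i
      using norm_triangle_ineq4[of "g 0 (i + 1)" "g 0 i"] unfolding h_def by (smt (verit))
    ultimately show ?case by (intro exI[of _ "2 * M"] exI[of _ "4 * M"]) simp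
  next
    case (Suc k)
    then obtain \<Gamma> H where \<Gamma>: "\<And>i. norm (g k i) \<le> \<Gamma>" and H: "\<And>i. norm (h k i) \<le> H"
      and le: "\<Gamma> + 4 * H \<le> 18 * M * exp (72 * C * (1 - 1 / 2 ^ k))" by blast
    have pos: "0 \<le> \<Gamma>" "0 \<le> H" using \<Gamma> H norm_ge_zero order_trans by blast+
    define \<epsilon> where "\<epsilon> = C / 2 ^ k"
    have \<epsilon>: "0 \<le> \<epsilon>" using C by (simp add: \<epsilon>_def)
    have "norm (g (Suc k) m) \<le> \<Gamma> + (H + 4 * \<epsilon> * \<Gamma>)" for m
    proof -
      have m: "2 * (m div 2) + m mod 2 = m" "m mod 2 \<in> {0, 1}" by auto
      show ?thesis
        using g_child[OF \<Gamma> H m(2), of "m div 2", unfolded m(1)] norm_triangle_sub[of "g (Suc k) m" "g k (m div 2)"] \<Gamma>[of "m div 2"]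
        by (simp add: \<epsilon>_def)
    qed
    moreover have "norm (h (Suc k) m) \<le> 21 / 32 * H + 8 * \<epsilon> * \<Gamma>" for m
      using h_step[OF \<Gamma> H, of m] by (simp add: \<epsilon>_def)
    moreover have "\<Gamma> + (H + 4 * \<epsilon> * \<Gamma>) + 4 * (21 / 32 * H + 8 * \<epsilon> * \<Gamma>)
        \<le> 18 * M * exp (72 * C * (1 - 1 / 2 ^ Suc k))"
    proof -
      \<comment> \<open>The coefficient of \<open>\<Gamma>\<close> is exactly 1 + 36 \<epsilon>;
        that of \<open>H\<close> is 1 + 21/8, below 4.\<close>
      have "\<Gamma> + (H + 4 * \<epsilon> * \<Gamma>) + 4 * (21 / 32 * H + 8 * \<epsilon> * \<Gamma>) \<le> (1 + 36 * \<epsilon>) * (\<Gamma> + 4 * H)"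
        using pos mult_nonneg_nonneg[OF \<epsilon> pos(2)] by (simp add: algebra_simps)
      also have "\<dots> \<le> exp (36 * \<epsilon>) * (18 * M * exp (72 * C * (1 - 1 / 2 ^ k)))"
        using pos le by (intro mult_mono exp_ge_add_one_self) auto
      also have "\<dots> = 18 * M * exp (36 * \<epsilon> + 72 * C * (1 - 1 / 2 ^ k))"
        by (simp add: exp_add)
      also have "36 * \<epsilon> + 72 * C * (1 - 1 / 2 ^ k) = 72 * C * (1 - 1 / 2 ^ Suc k)"
        by (simp add: \<epsilon>_def field_simps)
      finally show ?thesis .
    qed
    ultimately show ?case by (intro exI conjI allI)
  qed
  have P: "norm (g k i) \<le> P" "norm (h k i) \<le> P" for k i
  proof -
    obtain \<Gamma> H where \<Gamma>: "\<And>i. norm (g k i) \<le> \<Gamma>" and H: "\<And>i. norm (h k i) \<le> H"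
      and le: "\<Gamma> + 4 * H \<le> 18 * M * exp (72 * C * (1 - 1 / 2 ^ k))" using gh_bound by blast
    have "72 * C * (1 - 1 / 2 ^ k) \<le> 72 * C"
      using C by (intro mult_left_le) auto
    then have "18 * M * exp (72 * C * (1 - 1 / 2 ^ k)) \<le> P"
      using M0 by (simp add: P_def mult_left_mono)
    moreover have "0 \<le> \<Gamma>" "0 \<le> H" using \<Gamma> H norm_ge_zero order_trans by blast+
    ultimately show "norm (g k i) \<le> P" "norm (h k i) \<le> P"
      using \<Gamma>[of i] H[of i] le by linarith+
  qed
  have P0: "0 \<le> P" using M0 by (simp add: P_def)
  have half_le: "(1 / 2) ^ k \<le> (3 / 4 :: real) ^ k" for k by (intro power_mono) auto

  \<comment> \<open>The gap 3/4 - 21/32 = 3/32 must absorb the forcing 8 C P, whence 256/3 = 8 *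
    32/3; the summand \<open>P\<close> covers level 0.\<close>
  define K where "K = P + 256 / 3 * (C * P)"
  have CP: "0 \<le> C * P" using C P0 by simp
  have h_decay: "norm (h k i) \<le> K * (3 / 4) ^ k" for k i
  proof (induction k arbitrary: i)
    case 0 show ?case using P(2)[of 0 i] CP by (simp add: K_def)
  next
    case (Suc k)
    have "norm (h (Suc k) i) \<le> 21 / 32 * (K * (3 / 4) ^ k) + 8 * C / 2 ^ k * P"
      by (intro h_step Suc P)
    also have "8 * C / 2 ^ k * P = 8 * (C * P) * (1 / 2) ^ k" by (simp add: power_divide)
    also have "8 * (C * P) * (1 / 2) ^ k \<le> 8 * (C * P) * (3 / 4) ^ k"
      using CP half_le by (intro mult_left_mono) auto
    also have "8 * (C * P) * (3 / 4) ^ k \<le> 3 / 32 * K * (3 / 4) ^ k"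
      using P0 by (intro mult_right_mono) (auto simp: K_def)
    finally show ?case by simp
  qed

  have g_child': "norm (g (Suc k) (2 * i + l) - g k i) \<le> (K + 4 * (C * P)) * (3 / 4) ^ k"
    if "l \<in> {0, 1}" for k i l
  proof -
    have "norm (g (Suc k) (2 * i + l) - g k i) \<le> K * (3 / 4) ^ k + 4 * C / 2 ^ k * P"
      by (intro g_child P h_decay that)
    also have "4 * C / 2 ^ k * P = 4 * (C * P) * (1 / 2) ^ k" by (simp add: power_divide)
    also have "4 * (C * P) * (1 / 2) ^ k \<le> 4 * (C * P) * (3 / 4) ^ k"
      using CP half_le by (intro mult_left_mono) auto
    finally show ?thesis by (simp add: algebra_simps)
  qed
  have g_neighbour: "norm (g k (i + 1) - g k i) \<le> (K + 4 * (C * P)) * (3 / 4) ^ k" for k i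
    by (rule order_trans[OF h_decay[unfolded h_def]]) (use CP in \<open>auto intro!: mult_right_mono\<close>)
  \<comment> \<open>Child steps and neighbour jumps of \<open>g\<close> share one constant and the
    rate 3/4, as \<open>dyadic_limit\<close> requires.\<close>
  obtain D :: "real \<Rightarrow> 'a" where D: "continuous_on UNIV D"
    "\<And>k x. norm (g k \<lfloor>2 ^ k * x\<rfloor> - D x) \<le> (K + 4 * (C * P)) / (1 - 3 / 4) * (3 / 4) ^ k"
    by (rule dyadic_limit[OF g_child' g_neighbour]) (assumption | simp)+

  \<comment> \<open>Boundedness of \<open>g\<close> alone makes the steps of \<open>F\<close> decay
    like 2^-k; the extra decay of the defect is given away.\<close>
  have F_child: "norm (F (Suc k) (2 * i + l) - F k i) \<le> (1 + C) * P * (1 / 2) ^ k"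
    if "l \<in> {0, 1}" for k i l
  proof -
    have "norm (dual4 (F k) (2 * i + l) - F k i) \<le> P / 2 ^ k"
      using d_g[OF P(1)] that by (intro dual4_minus_parent) (auto simp: d_def)
    then have "norm (r k (2 * i + l) + (dual4 (F k) (2 * i + l) - F k i)) \<le> C / 2 ^ k * (P / 2 ^ k) + P / 2 ^ k"
      by (intro norm_triangle_mono r P)
    also have "C / 2 ^ k * (P / 2 ^ k) \<le> C * (P / 2 ^ k)"
      using C P0 divide_left_mono[of 1 "2 ^ k" C] by (intro mult_right_mono) auto
    finally show ?thesis by (simp add: r_def power_divide add_divide_distrib algebra_simps)
  qed
  have F_neighbour: "norm (F k (i + 1) - F k i) \<le> (1 + C) * P * (1 / 2) ^ k" for k i
  proof -
    have "norm (F k (i + 1) - F k i) \<le> P * (1 / 2) ^ k"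
      using d_g[OF P(1), of k i] by (simp add: d_def power_divide)
    also have "\<dots> \<le> (1 + C) * P * (1 / 2) ^ k"
      using CP by (intro mult_right_mono) (auto simp: algebra_simps)
    finally show ?thesis .
  qed
  obtain U :: "real \<Rightarrow> 'a" where U: "continuous_on UNIV U"
    "\<And>k x. norm (F k \<lfloor>2 ^ k * x\<rfloor> - U x) \<le> (1 + C) * P / (1 - 1 / 2) * (1 / 2) ^ k"
    by (rule dyadic_limit[OF F_child F_neighbour]) (assumption | simp)+
  \<comment> \<open>At dyadic nodes the floor is exact, so the estimates transfer to the
    grid.\<close>
  have at_int: "\<lfloor>2 ^ k * (of_int i / 2 ^ k :: real)\<rfloor> = i" for k i by simp
  show ?thesis
  proof (rule that)
    show "norm (F k i - U (of_int i / 2 ^ k)) \<le> 2 * ((1 + C) * P) / 2 ^ k" for k i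
      using U(2)[of k "of_int i / 2 ^ k"] unfolding at_int by (simp add: power_divide mult.commute)
    show "(U has_vector_derivative D x) (at x)" for x
    proof (rule dyadic_limit_has_vector_derivative[OF _ _ _ D(1)])
      show "(\<lambda>k. F k \<lfloor>2 ^ k * x\<rfloor>) \<longlonglongrightarrow> U x" for x
        by (rule LIM_zero_cancel, rule Lim_null_comparison[OF always_eventually[OF allI[OF U(2)]]])
           (intro tendsto_mult_right_zero LIMSEQ_realpow_zero; simp)
      show "norm (2 ^ k *\<^sub>R (F k (i + 1) - F k i) - D (of_int i / 2 ^ k))
          \<le> (K + 4 * (C * P)) / (1 - 3 / 4) * (3 / 4) ^ k" for k i
        using D(2)[of k "of_int i / 2 ^ k"] unfolding at_int by (simp add: g_def d_def)
      show "(\<lambda>k. (K + 4 * (C * P)) / (1 - 3 / 4) * (3 / 4) ^ k) \<longlonglongrightarrow> 0"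
        by (intro tendsto_mult_right_zero LIMSEQ_realpow_zero) auto
    qed
  qed (rule D(1))
qed

section \<open>The coefficients of the Lagrange rules near the uniform grid\<close>

text \<open>The window is the range of the clamped parameters at a level with \<epsilon> = \<rho> /
  2^k, and \<open>R\<close> covers all levels at once. Comparison with the single point (1, 1) is
  stable under sums, products and inverses, so no derivatives are needed.\<close>

definition lipschitz_near_1 :: "real \<Rightarrow> (real \<Rightarrow> real \<Rightarrow> real) \<Rightarrow> bool" where
  "lipschitz_near_1 R \<phi> \<longleftrightarrow> (\<exists>M\<ge>0. \<forall>\<epsilon>\<in>{0..R}. \<forall>\<alpha>\<in>{inverse (1 + \<epsilon>)..1 + \<epsilon>}. \<forall>\<beta>\<in>{inverse (1 + \<epsilon>)..1 + \<epsilon>}.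
     \<bar>\<phi> \<alpha> \<beta> - \<phi> 1 1\<bar> \<le> M * \<epsilon>)"

lemma lipschitz_near_1I:
  assumes "\<And>\<epsilon> \<alpha> \<beta>. \<lbrakk>0 \<le> \<epsilon>; \<epsilon> \<le> R; \<alpha> \<in> {inverse (1 + \<epsilon>)..1 + \<epsilon>}; \<beta> \<in> {inverse (1 + \<epsilon>)..1 + \<epsilon>}\<rbrakk>
      \<Longrightarrow> \<bar>\<phi> \<alpha> \<beta> - \<phi> 1 1\<bar> \<le> M * \<epsilon>" and "0 \<le> M"
  shows "lipschitz_near_1 R \<phi>"
  using assms unfolding lipschitz_near_1_def by (intro exI[of _ M]) auto

lemma lipschitz_near_1E:
  assumes "lipschitz_near_1 R \<phi>"
  obtains M where "0 \<le> M"
    "\<And>\<epsilon> \<alpha> \<beta>. \<lbrakk>0 \<le> \<epsilon>; \<epsilon> \<le> R; \<alpha> \<in> {inverse (1 + \<epsilon>)..1 + \<epsilon>}; \<beta> \<in> {inverse (1 + \<epsilon>)..1 + \<epsilon>}\<rbrakk>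
      \<Longrightarrow> \<bar>\<phi> \<alpha> \<beta> - \<phi> 1 1\<bar> \<le> M * \<epsilon>"
proof -
  obtain M where "0 \<le> M" "\<forall>\<epsilon>\<in>{0..R}. \<forall>\<alpha>\<in>{inverse (1 + \<epsilon>)..1 + \<epsilon>}. \<forall>\<beta>\<in>{inverse (1 + \<epsilon>)..1 + \<epsilon>}.
     \<bar>\<phi> \<alpha> \<beta> - \<phi> 1 1\<bar> \<le> M * \<epsilon>"
    using assms unfolding lipschitz_near_1_def by blast
  then show ?thesis by (intro that[of M]) simp_all
qed

lemma abs_minus_1_le:
  fixes x \<epsilon> :: real
  assumes "0 \<le> \<epsilon>" "x \<in> {inverse (1 + \<epsilon>)..1 + \<epsilon>}"
  shows "\<bar>x - 1\<bar> \<le> \<epsilon>"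
proof -
  have "(1 - \<epsilon>) * (1 + \<epsilon>) \<le> 1" by (simp add: algebra_simps)
  then have "1 - \<epsilon> \<le> inverse (1 + \<epsilon>)"
    using assms(1) by (simp add: inverse_eq_divide pos_le_divide_eq)
  then show ?thesis using assms(2) by auto
qed

lemma lipschitz_near_1_const: "lipschitz_near_1 R (\<lambda>\<alpha> \<beta>. c)"
  by (rule lipschitz_near_1I[of _ _ 0]) auto

lemma lipschitz_near_1_proj: "lipschitz_near_1 R (\<lambda>\<alpha> \<beta>. \<alpha>)" "lipschitz_near_1 R (\<lambda>\<alpha> \<beta>. \<beta>)"
  by (rule lipschitz_near_1I[of _ _ 1]; simp add: abs_minus_1_le)+

lemma lipschitz_near_1_add:
  assumes "lipschitz_near_1 R \<phi>" "lipschitz_near_1 R \<psi>"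
  shows "lipschitz_near_1 R (\<lambda>\<alpha> \<beta>. \<phi> \<alpha> \<beta> + \<psi> \<alpha> \<beta>)"
proof -
  obtain M N where M: "0 \<le> M" "\<And>\<epsilon> \<alpha> \<beta>. \<lbrakk>0 \<le> \<epsilon>; \<epsilon> \<le> R; \<alpha> \<in> {inverse (1 + \<epsilon>)..1 + \<epsilon>}; \<beta> \<in> {inverse (1 + \<epsilon>)..1 + \<epsilon>}\<rbrakk>
      \<Longrightarrow> \<bar>\<phi> \<alpha> \<beta> - \<phi> 1 1\<bar> \<le> M * \<epsilon>"
    and N: "0 \<le> N" "\<And>\<epsilon> \<alpha> \<beta>. \<lbrakk>0 \<le> \<epsilon>; \<epsilon> \<le> R; \<alpha> \<in> {inverse (1 + \<epsilon>)..1 + \<epsilon>}; \<beta> \<in> {inverse (1 + \<epsilon>)..1 + \<epsilon>}\<rbrakk>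
      \<Longrightarrow> \<bar>\<psi> \<alpha> \<beta> - \<psi> 1 1\<bar> \<le> N * \<epsilon>"
    using assms by (elim lipschitz_near_1E) blast
  show ?thesis
  proof (rule lipschitz_near_1I[of _ _ "M + N"])
    fix \<epsilon> \<alpha> \<beta> :: real
    assume *: "0 \<le> \<epsilon>" "\<epsilon> \<le> R" "\<alpha> \<in> {inverse (1 + \<epsilon>)..1 + \<epsilon>}" "\<beta> \<in> {inverse (1 + \<epsilon>)..1 + \<epsilon>}"
    show "\<bar>\<phi> \<alpha> \<beta> + \<psi> \<alpha> \<beta> - (\<phi> 1 1 + \<psi> 1 1)\<bar> \<le> (M + N) * \<epsilon>"
      using M(2)[OF *] N(2)[OF *] by (simp add: distrib_right)
  qed (use M N in simp)
qed

lemma lipschitz_near_1_mult: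
  assumes "lipschitz_near_1 R \<phi>" "lipschitz_near_1 R \<psi>"
  shows "lipschitz_near_1 R (\<lambda>\<alpha> \<beta>. \<phi> \<alpha> \<beta> * \<psi> \<alpha> \<beta>)"
proof -
  obtain M N where M: "0 \<le> M" "\<And>\<epsilon> \<alpha> \<beta>. \<lbrakk>0 \<le> \<epsilon>; \<epsilon> \<le> R; \<alpha> \<in> {inverse (1 + \<epsilon>)..1 + \<epsilon>}; \<beta> \<in> {inverse (1 + \<epsilon>)..1 + \<epsilon>}\<rbrakk>
      \<Longrightarrow> \<bar>\<phi> \<alpha> \<beta> - \<phi> 1 1\<bar> \<le> M * \<epsilon>"
    and N: "0 \<le> N" "\<And>\<epsilon> \<alpha> \<beta>. \<lbrakk>0 \<le> \<epsilon>; \<epsilon> \<le> R; \<alpha> \<in> {inverse (1 + \<epsilon>)..1 + \<epsilon>}; \<beta> \<in> {inverse (1 + \<epsilon>)..1 + \<epsilon>}\<rbrakk>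
      \<Longrightarrow> \<bar>\<psi> \<alpha> \<beta> - \<psi> 1 1\<bar> \<le> N * \<epsilon>"
    using assms by (elim lipschitz_near_1E) blast
  show ?thesis
  \<comment> \<open>The absolute value keeps the constant nonnegative for negative \<open>R\<close>
    too, where the condition is vacuous.\<close>
  proof (rule lipschitz_near_1I[of _ _ "(\<bar>\<phi> 1 1\<bar> + M * \<bar>R\<bar>) * N + M * \<bar>\<psi> 1 1\<bar>"])
    fix \<epsilon> \<alpha> \<beta> :: real
    assume *: "0 \<le> \<epsilon>" "\<epsilon> \<le> R" "\<alpha> \<in> {inverse (1 + \<epsilon>)..1 + \<epsilon>}" "\<beta> \<in> {inverse (1 + \<epsilon>)..1 + \<epsilon>}"
    have "M * \<epsilon> \<le> M * \<bar>R\<bar>" using M(1) * by (intro mult_left_mono) auto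
    then have \<phi>: "\<bar>\<phi> \<alpha> \<beta>\<bar> \<le> \<bar>\<phi> 1 1\<bar> + M * \<bar>R\<bar>"
      using M(2)[OF *] by linarith
    have "\<phi> \<alpha> \<beta> * \<psi> \<alpha> \<beta> - \<phi> 1 1 * \<psi> 1 1
        = \<phi> \<alpha> \<beta> * (\<psi> \<alpha> \<beta> - \<psi> 1 1) + (\<phi> \<alpha> \<beta> - \<phi> 1 1) * \<psi> 1 1"
      by (simp add: algebra_simps)
    also have "\<bar>\<dots>\<bar> \<le> \<bar>\<phi> \<alpha> \<beta>\<bar> * \<bar>\<psi> \<alpha> \<beta> - \<psi> 1 1\<bar> + \<bar>\<phi> \<alpha> \<beta> - \<phi> 1 1\<bar> * \<bar>\<psi> 1 1\<bar>"
      by (rule order_trans[OF abs_triangle_ineq]) (simp add: abs_mult)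
    also have "\<dots> \<le> (\<bar>\<phi> 1 1\<bar> + M * \<bar>R\<bar>) * (N * \<epsilon>) + (M * \<epsilon>) * \<bar>\<psi> 1 1\<bar>"
      using M N * by (intro add_mono mult_mono \<phi>) auto
    finally show "\<bar>\<phi> \<alpha> \<beta> * \<psi> \<alpha> \<beta> - \<phi> 1 1 * \<psi> 1 1\<bar> \<le> ((\<bar>\<phi> 1 1\<bar> + M * \<bar>R\<bar>) * N + M * \<bar>\<psi> 1 1\<bar>) * \<epsilon>"
      by (simp add: algebra_simps)
  qed (use M N in simp)
qed

lemma lipschitz_near_1_minus: "lipschitz_near_1 R \<phi> \<Longrightarrow> lipschitz_near_1 R (\<lambda>\<alpha> \<beta>. - \<phi> \<alpha> \<beta>)"
  using lipschitz_near_1_mult[OF lipschitz_near_1_const[of R "- 1"], of \<phi>] by simp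

text \<open>|1/x - 1/y| = |x - y| / (x y), with both values at least \<open>m\<close>;
  \<open>0 \<le> R\<close> places (1, 1) in the region of the lower bound.\<close>

lemma lipschitz_near_1_inverse:
  assumes \<phi>: "lipschitz_near_1 R \<phi>" and R: "0 \<le> R" and m: "0 < m"
    "\<And>\<alpha> \<beta>. inverse (1 + R) \<le> \<alpha> \<Longrightarrow> inverse (1 + R) \<le> \<beta> \<Longrightarrow> m \<le> \<phi> \<alpha> \<beta>"
  shows "lipschitz_near_1 R (\<lambda>\<alpha> \<beta>. inverse (\<phi> \<alpha> \<beta>))"
proof -
  obtain M where M: "0 \<le> M" "\<And>\<epsilon> \<alpha> \<beta>. \<lbrakk>0 \<le> \<epsilon>; \<epsilon> \<le> R; \<alpha> \<in> {inverse (1 + \<epsilon>)..1 + \<epsilon>}; \<beta> \<in> {inverse (1 + \<epsilon>)..1 + \<epsilon>}\<rbrakk>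
      \<Longrightarrow> \<bar>\<phi> \<alpha> \<beta> - \<phi> 1 1\<bar> \<le> M * \<epsilon>"
    using \<phi> by (elim lipschitz_near_1E) blast
  have m1: "m \<le> \<phi> 1 1" using R by (intro m) (auto simp: inverse_le_1_iff)
  show ?thesis
  proof (rule lipschitz_near_1I[of _ _ "M / (m * m)"])
    fix \<epsilon> \<alpha> \<beta> :: real
    assume *: "0 \<le> \<epsilon>" "\<epsilon> \<le> R" "\<alpha> \<in> {inverse (1 + \<epsilon>)..1 + \<epsilon>}" "\<beta> \<in> {inverse (1 + \<epsilon>)..1 + \<epsilon>}"
    have "inverse (1 + R) \<le> inverse (1 + \<epsilon>)" using * by (intro le_imp_inverse_le) auto
    then have m2: "m \<le> \<phi> \<alpha> \<beta>"
      using *(3,4) unfolding atLeastAtMost_iff by (intro m) linarith+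
    have "inverse (\<phi> \<alpha> \<beta>) - inverse (\<phi> 1 1) = (\<phi> 1 1 - \<phi> \<alpha> \<beta>) / (\<phi> \<alpha> \<beta> * \<phi> 1 1)"
      using m(1) m1 m2 by (simp add: field_simps)
    also have "\<bar>\<dots>\<bar> = \<bar>\<phi> \<alpha> \<beta> - \<phi> 1 1\<bar> / (\<phi> \<alpha> \<beta> * \<phi> 1 1)"
      using m(1) m1 m2 by (simp add: abs_mult abs_minus_commute)
    also have "\<dots> \<le> (M * \<epsilon>) / (m * m)"
      using m(1) m1 m2 M * by (intro frac_le mult_mono) auto
    finally show "\<bar>inverse (\<phi> \<alpha> \<beta>) - inverse (\<phi> 1 1)\<bar> \<le> M / (m * m) * \<epsilon>" by simp
  qed (use M m in simp)
qed

lemma lipschitz_near_1_lagrange_coeff: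
  assumes R: "0 \<le> R"
  shows "lipschitz_near_1 R (lagrange_coeff j)"
proof -
  define c where "c = inverse (1 + R)"
  have c: "0 < c" using R by (simp add: c_def)
  \<comment> \<open>Each denominator has the form 64 x y with x \<ge> c and y \<ge> 1. Squares are
    written as products to match the unfolded coefficients.\<close>
  have lower: "c \<le> 64 * (\<alpha> * \<alpha> + \<alpha>) * (\<alpha> + \<beta> + 1)" "c \<le> 64 * \<alpha> * (\<beta> + 1)"
    "c \<le> 64 * \<beta> * (\<alpha> + 1)" "c \<le> 64 * (\<beta> * \<beta> + \<beta>) * (\<alpha> + \<beta> + 1)"
    if "inverse (1 + R) \<le> \<alpha>" "inverse (1 + R) \<le> \<beta>" for \<alpha> \<beta>
  proof -
    have le: "c \<le> 64 * x * y" if "c \<le> x" "1 \<le> y" for x y :: real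
      using mult_mono[of "c" "64 * x" 1 y] that c by simp
    have "c \<le> \<alpha>" "c \<le> \<beta>" "0 \<le> \<alpha> * \<alpha>" "0 \<le> \<beta> * \<beta>" using that by (auto simp: c_def)
    then show "c \<le> 64 * (\<alpha> * \<alpha> + \<alpha>) * (\<alpha> + \<beta> + 1)" "c \<le> 64 * \<alpha> * (\<beta> + 1)"
      "c \<le> 64 * \<beta> * (\<alpha> + 1)" "c \<le> 64 * (\<beta> * \<beta> + \<beta>) * (\<alpha> + \<beta> + 1)"
      using c by (intro le; linarith)+
  qed
  note lip = lipschitz_near_1_const lipschitz_near_1_proj lipschitz_near_1_add lipschitz_near_1_mult
    lipschitz_near_1_minus
  note inv = lipschitz_near_1_inverse[OF _ R c]
  consider "j = -1" | "j = 0" | "j = 1" | "j = 2" | "j \<notin> {-1, 0, 1, 2}" by blast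
  then show ?thesis
  proof cases
    case 1
    show ?thesis
      unfolding 1 lagrange_coeff_simps(1)[abs_def] divide_inverse power2_eq_square
      by (rule lip inv lower | assumption)+
  next
    case 2
    show ?thesis
      unfolding 2 lagrange_coeff_simps(2)[abs_def] divide_inverse power2_eq_square
      by (rule lip inv lower | assumption)+
  next
    case 3
    show ?thesis
      unfolding 3 lagrange_coeff_simps(3)[abs_def] divide_inverse power2_eq_square
      by (rule lip inv lower | assumption)+
  next
    case 4
    show ?thesis
      unfolding 4 lagrange_coeff_simps(4)[abs_def] divide_inverse power2_eq_square
      by (rule lip inv lower | assumption)+
  next
    case 5
    then show ?thesis
      using lipschitz_near_1_const[of R 0] by (simp add: lagrange_coeff_def[abs_def])
  qed
qed

lemma minus1_to_2_eq: "{- 1..2 :: int} = {- 1, 0, 1, 2}"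
  by auto

text \<open>The coefficients are the cubic Lagrange basis for the nodes -\<alpha>, 0, 1, 1 + \<beta>
  at 1/4, and constants are interpolated exactly.\<close>

lemma sum_lagrange_coeff:
  assumes "0 < \<alpha>" "0 < \<beta>"
  shows "(\<Sum>j\<in>{-1..2}. lagrange_coeff j \<alpha> \<beta>) = 1"
proof -
  have nz: "\<alpha> \<noteq> 0" "\<alpha> + 1 \<noteq> 0" "\<beta> \<noteq> 0" "\<beta> + 1 \<noteq> 0" "\<alpha> + \<beta> + 1 \<noteq> 0" using assms by auto
  have sq: "x\<^sup>2 + x = x * (x + 1)" for x :: real by (simp add: power2_eq_square algebra_simps)
  have "- (3 * (4 * \<beta> + 3)) / (64 * (\<alpha> * (\<alpha> + 1)) * (\<alpha> + \<beta> + 1))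
      + 3 * (4 * \<alpha> + 1) * (4 * \<beta> + 3) / (64 * \<alpha> * (\<beta> + 1))
      + (4 * \<alpha> + 1) * (4 * \<beta> + 3) / (64 * \<beta> * (\<alpha> + 1))
      + - (3 * (4 * \<alpha> + 1)) / (64 * (\<beta> * (\<beta> + 1)) * (\<alpha> + \<beta> + 1)) = 1"
    using nz by (simp add: divide_simps) algebra
  then show ?thesis
    by (simp add: minus1_to_2_eq lagrange_coeff_simps sq add.assoc)
qed

text \<open>Equal weight sums allow \<open>v\<close> to be subtracted from every point, so the
  coefficient error multiplies the spread of the data and not its size.\<close>

lemma norm_diff_combinations_le:
  fixes w :: "'i \<Rightarrow> 'a::real_normed_vector"
  assumes "sum a I = sum b I" and ab: "\<And>j. j \<in> I \<Longrightarrow> \<bar>a j - b j\<bar> \<le> \<eta>"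
    and w: "\<And>j. j \<in> I \<Longrightarrow> norm (w j - v) \<le> \<delta>"
  shows "norm ((\<Sum>j\<in>I. a j *\<^sub>R w j) - (\<Sum>j\<in>I. b j *\<^sub>R w j)) \<le> of_nat (card I) * (\<eta> * \<delta>)"
proof -
  have "(\<Sum>j\<in>I. (a j - b j) *\<^sub>R v) = 0"
    using assms(1) by (simp add: scaleR_left.sum[symmetric] sum_subtractf)
  then have "(\<Sum>j\<in>I. a j *\<^sub>R w j) - (\<Sum>j\<in>I. b j *\<^sub>R w j) = (\<Sum>j\<in>I. (a j - b j) *\<^sub>R (w j - v))"
    by (simp add: scaleR_diff_right scaleR_diff_left sum_subtractf)
  also have "norm \<dots> \<le> of_nat (card I) * (\<eta> * \<delta>)"
  proof (rule sum_norm_bound)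
    fix j assume "j \<in> I"
    then show "norm ((a j - b j) *\<^sub>R (w j - v)) \<le> \<eta> * \<delta>"
      using mult_mono[OF ab w, of j j] order_trans[OF abs_ge_zero ab, of j] by simp
  qed
  finally show ?thesis .
qed

section \<open>Distance of the scheme from the dual four-point scheme\<close>

lemma alpha_bounds_level:
  assumes "0 \<le> \<rho>"
  shows "alpha \<rho> k A B \<in> {inverse (1 + \<rho> / 2 ^ k)..1 + \<rho> / 2 ^ k}"
proof -
  have "inverse (1 + \<rho> / 2 ^ k) \<le> 1" using assms by (simp add: inverse_le_1_iff)
  moreover have "1 \<le> 1 + \<rho> / 2 ^ k" using assms by simp
  ultimately show ?thesis unfolding alpha_def by auto
qed

lemma dual4_eq_Lambda:
  fixes l :: int
  assumes "l \<in> {0, 1}"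
  shows "dual4 f (2 * i + l) = (if l = 0 then Lambda0 1 1 (\<lambda>j. f (i + j)) else Lambda1 1 1 (\<lambda>j. f (i + j)))"
  using assms
  by (auto simp: dual4_double[of _ i, simplified] Lambda0_def Lambda1_def minus1_to_2_eq lagrange_coeff_simps)

text \<open>The data influence the rule only through clamped parameters, so one constant serves all
  sequences, degenerate ones included.\<close>

lemma subdiv_near_dual4:
  fixes \<rho> :: real
  assumes \<rho>: "0 \<le> \<rho>"
  obtains C where "0 \<le> C"
    "\<And>k m \<delta> (f :: 'n::finite sequence). (\<And>i. norm (f (i + 1) - f i) \<le> \<delta>) \<Longrightarrow>
      norm (subdiv \<rho> k f m - dual4 f m) \<le> C / 2 ^ k * \<delta>"
proof -
  have "\<exists>M\<ge>0. \<forall>\<epsilon>\<in>{0..\<rho>}. \<forall>\<alpha>\<in>{inverse (1 + \<epsilon>)..1 + \<epsilon>}. \<forall>\<beta>\<in>{inverse (1 + \<epsilon>)..1 + \<epsilon>}.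
     \<bar>lagrange_coeff j \<alpha> \<beta> - lagrange_coeff j 1 1\<bar> \<le> M * \<epsilon>" for j
    using lipschitz_near_1_lagrange_coeff[OF \<rho>, of j] by (simp only: lipschitz_near_1_def)
  then obtain M where M0: "\<And>j. 0 \<le> M j"
    and M: "\<And>j \<epsilon> \<alpha> \<beta>. \<epsilon> \<in> {0..\<rho>} \<Longrightarrow> \<alpha> \<in> {inverse (1 + \<epsilon>)..1 + \<epsilon>} \<Longrightarrow> \<beta> \<in> {inverse (1 + \<epsilon>)..1 + \<epsilon>} \<Longrightarrow>
      \<bar>lagrange_coeff j \<alpha> \<beta> - lagrange_coeff j 1 1\<bar> \<le> M j * \<epsilon>"
    by metis
  define N where "N = sum M {-1..2}"
  show ?thesis
  \<comment> \<open>Four coefficients times a spread of \<open>2 * \<delta>\<close> give the factor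
    8.\<close>
  proof (rule that[of "8 * (N * \<rho>)"])
    show "0 \<le> 8 * (N * \<rho>)" using \<rho> M0 by (auto simp: N_def intro!: sum_nonneg mult_nonneg_nonneg)
    fix k \<delta> and m :: int and f :: "'n sequence"
    assume f: "\<And>i. norm (f (i + 1) - f i) \<le> \<delta>"
    define \<epsilon> where "\<epsilon> = \<rho> / 2 ^ k"
    have \<epsilon>: "\<epsilon> \<in> {0..\<rho>}" using \<rho> divide_left_mono[of 1 "2 ^ k" \<rho>] by (auto simp: \<epsilon>_def)
    define i l where "i = m div 2" and "l = m mod 2"
    have m: "m = 2 * i + l" and l: "l \<in> {0, 1}" by (auto simp: i_def l_def)
    define w where "w j = f (i + j)" for j
    \<comment> \<open>The dependence of the parameters on \<open>f\<close> is forgotten here; only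
      their window is kept.\<close>
    obtain \<alpha> \<beta> where \<alpha>\<beta>: "\<alpha> \<in> {inverse (1 + \<epsilon>)..1 + \<epsilon>}" "\<beta> \<in> {inverse (1 + \<epsilon>)..1 + \<epsilon>}"
      and eq: "subdiv \<rho> k f m = (if l = 0 then Lambda0 \<alpha> \<beta> w else Lambda1 \<alpha> \<beta> w)"
      using alpha_bounds_level[OF \<rho>, of k]
      unfolding subdiv_def Psi_def Let_def beta_def i_def l_def w_def[abs_def] \<epsilon>_def by blast
    have "0 < inverse (1 + \<epsilon>)" using \<epsilon> by simp
    then have pos: "0 < \<alpha>" "0 < \<beta>" using \<alpha>\<beta> unfolding atLeastAtMost_iff by linarith+
    \<comment> \<open>Both orders of the parameters are covered because \<open>Lambda1\<close> swaps
      them.\<close>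
    have coeff: "\<bar>lagrange_coeff j x y - lagrange_coeff j 1 1\<bar> \<le> N * \<epsilon>"
      if "j \<in> {-1..2}" "x \<in> {\<alpha>, \<beta>}" "y \<in> {\<alpha>, \<beta>}" for j x y
    proof -
      have "M j \<le> N" unfolding N_def using that(1) M0 by (intro member_le_sum) auto
      then have "M j * \<epsilon> \<le> N * \<epsilon>" using \<epsilon> by (intro mult_right_mono) auto
      then show ?thesis using M[OF \<epsilon>, of x y j] that \<alpha>\<beta> by auto
    qed
    have w: "norm (w j - w 0) \<le> 2 * \<delta>" if "j \<in> {-1..2}" for j
    proof -
      have "norm (w (-1) - w 0) \<le> \<delta>" "norm (w 1 - w 0) \<le> \<delta>" "norm (w 2 - w 1) \<le> \<delta>"
        using f[of "i - 1"] f[of i] f[of "i + 1"] by (auto simp: w_def norm_minus_commute add.assoc)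
      moreover have "norm (w 2 - w 0) \<le> norm (w 2 - w 1) + norm (w 1 - w 0)"
        using norm_triangle_ineq[of "w 2 - w 1" "w 1 - w 0"] by simp
      moreover have "0 \<le> \<delta>" using f norm_ge_zero order_trans by blast
      ultimately show ?thesis
        using that unfolding minus1_to_2_eq by auto
    qed
    have "norm (Lambda0 \<alpha> \<beta> w - Lambda0 1 1 w) \<le> of_nat (card {-1..2::int}) * ((N * \<epsilon>) * (2 * \<delta>))"
      unfolding Lambda0_def using pos
      by (intro norm_diff_combinations_le[where v = "w 0"] coeff w) (auto simp: sum_lagrange_coeff)
    moreover have "norm (Lambda1 \<alpha> \<beta> w - Lambda1 1 1 w) \<le> of_nat (card {-1..2::int}) * ((N * \<epsilon>) * (2 * \<delta>))"
    proof -
      \<comment> \<open>The reflection \<open>j \<mapsto> 1 - j\<close> permutes the index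
        set.\<close>
      have "(\<Sum>j\<in>{-1..2}. lagrange_coeff (1 - j) x y) = 1" if "0 < x" "0 < y" for x y
        using sum_lagrange_coeff[OF that] by (simp add: minus1_to_2_eq)
      then show ?thesis
        unfolding Lambda1_def using pos
        by (intro norm_diff_combinations_le[where v = "w 0"] coeff w) auto
    qed
    ultimately have "norm (subdiv \<rho> k f m - dual4 f m) \<le> 4 * ((N * \<epsilon>) * (2 * \<delta>))"
      unfolding eq using dual4_eq_Lambda[OF l, of f i] by (simp add: m w_def[abs_def])
    then show "norm (subdiv \<rho> k f m - dual4 f m) \<le> 8 * (N * \<rho>) / 2 ^ k * \<delta>"
      by (simp add: \<epsilon>_def)
  qed
qed

section \<open>Uniform convergence and regularity of the scheme\<close>

lemma converges_uniformly_toI: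
  fixes F :: "nat \<Rightarrow> 'n::finite sequence"
  assumes "\<And>k i. norm (F k i - G (of_int i / 2 ^ k)) \<le> t k" and t: "t \<longlonglongrightarrow> 0"
  shows "converges_uniformly_to F G"
  unfolding converges_uniformly_to_def
proof (intro allI)
  fix a b :: real
  show "(\<lambda>k. SUP i\<in>{i::int. of_int i \<in> (\<lambda>x. 2 ^ k * x) ` {a..b}}.
      ennreal (norm (F k i - G (of_int i / 2 ^ k)))) \<longlonglongrightarrow> 0" (is "?s \<longlonglongrightarrow> 0")
  proof (rule tendsto_sandwich[OF _ _ tendsto_const])
    show "\<forall>\<^sub>F k in sequentially. 0 \<le> ?s k" by simp
    show "\<forall>\<^sub>F k in sequentially. ?s k \<le> ennreal (t k)"
      by (intro always_eventually allI SUP_least ennreal_leI assms(1))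
    show "(\<lambda>k. ennreal (t k)) \<longlonglongrightarrow> 0"
      using tendsto_ennrealI[OF t] by simp
  qed
qed

theorem mainTheorem2:
  fixes \<rho> :: real
  assumes "CARD('n::finite) \<ge> 2"
    and "\<rho> \<ge> 0"
  shows "C1_scheme (subdiv \<rho> :: 'n scheme)"
proof -
  let ?S = "subdiv \<rho> :: 'n scheme"
  obtain C where C: "0 \<le> C"
    "\<And>k m \<delta> (f :: 'n sequence). (\<And>i. norm (f (i + 1) - f i) \<le> \<delta>) \<Longrightarrow>
      norm (?S k f m - dual4 f m) \<le> C / 2 ^ k * \<delta>"
    using subdiv_near_dual4[OF assms(2)] by blast
  have limit: "\<exists>G. continuous_on UNIV G \<and> converges_uniformly_to (iterates ?S f) G \<and> G C1_differentiable_on UNIV"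
    if "f \<in> linfty" for f
  proof -
    obtain U D B where U: "\<And>x. (U has_vector_derivative D x) (at x)" and D: "continuous_on UNIV D"
      and B: "\<And>k i. norm (iterates ?S f k i - U (of_int i / 2 ^ k)) \<le> B / 2 ^ k"
    proof (rule perturbed_dual4_limit[of "iterates ?S f" C])
      show "bounded (range (iterates ?S f 0))" using \<open>f \<in> linfty\<close> by (simp add: linfty_def)
    qed (use C in auto)
    have "converges_uniformly_to (iterates ?S f) U"
      using B by (rule converges_uniformly_toI) (rule LIMSEQ_divide_realpow_zero, simp)
    moreover have "continuous_on UNIV U"
      using U by (intro continuous_at_imp_continuous_on ballI has_vector_derivative_continuous)
    moreover have "U C1_differentiable_on UNIV"
      using U D by (auto simp: C1_differentiable_on_def)
    ultimately show ?thesis by blast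
  qed
  have "\<exists>f\<in>linfty. scheme_limit ?S f \<noteq> (\<lambda>x. 0)"
  proof
    let ?f = "\<lambda>_. 1 :: real ^ 'n"
    show "?f \<in> linfty" by (simp add: linfty_def)
    have "?S k ?f = ?f" for k
    proof
      fix m
      have "dual4 ?f m = ?f m"
        by (simp add: dual4_def Let_def vec_eq_iff)
      \<comment> \<open>Constant data admit \<delta> = 0, so the perturbation bound forces agreement
        with \<open>dual4\<close>, which fixes constants.\<close>
      then show "?S k ?f m = ?f m" using C(2)[of ?f 0 k m] by simp
    qed
    then have "iterates ?S ?f k = ?f" for k by (induction k) auto
    then have "scheme_limit ?S ?f = (\<lambda>_. 1)"
      by (intro scheme_limit_eqI converges_uniformly_toI[where t = "\<lambda>_. 0"]) auto
    then show "scheme_limit ?S ?f \<noteq> (\<lambda>x. 0)"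
      by (simp add: fun_eq_iff)
  qed
  moreover have "scheme_limit ?S f C1_differentiable_on UNIV" if "f \<in> linfty" for f
    using limit[OF that] scheme_limit_eqI by metis
  ultimately show ?thesis
    using limit unfolding C1_scheme_def convergent_scheme_def by blast
qed

end
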